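(* Let $\mathcal H$ be a real Hilbert space, $A,B:\mathcal H\to2^{\mathcal H}$ maximal monotone, $C:\mathcal H\to\mathcal H$ $\beta$-cocoercive with $\beta>0$. Let $\varepsilon\in(0,1)$, $\gamma\in(0,2\beta\varepsilon)$, $\alpha=1/(2-\varepsilon)$. Let $T:=I_{\mathcal H}-J_{\gamma B}+J_{\gamma A}\circ(2J_{\gamma B}-I_{\mathcal H}-\gamma C\circ J_{\gamma B})$ have a fixed point $z^\ast$, and let $x^\ast=J_{\gamma B}(z^\ast)$. Let $z^0\in\mathcal H$, $z^{k+1}=(1-\lambda_k)z^k+\lambda_kTz^k$, $x_B^k:=J_{\gamma B}(z^k)$, $x_A^k:=J_{\gamma A}(2x_B^k-z^k-\gamma Cx_B^k)$. Write $$q_k:=Q_A(x_A^k,x^\ast)+Q_B(x_B^k,x^\ast)+Q_C(x_B^k,x^\ast),$$ with $Q_A,Q_B,Q_C$ as defined in the context. Then for all $k\ge0$: 1. (Nonergodic) If $(\lambda_j)\subseteq(0,1/\alpha)$ and $\underline\tau:=\inf_{j\ge0}\lambda_j(1-\alpha\lambda_j)/\alpha>0$, then $q_k\le\dfrac{(1+\gamma/\beta)\|z^0-z^\ast\|^2}{\gamma\sqrt{\underline\tau(k+1)}}$ and $q_k=o(1/\sqrt{k+1})$. 2. ("Best" iterate) If $(\lambda_j)\subseteq(0,1/\alpha)$, $\inf_{j\ge0}\lambda_j(1-\alpha\lambda_j)/\alpha>0$, and $\underline\lambda:=\inf_{j\ge0}\lambda_j$, then $\min_{i=0,\dots,k}q_i\le\dfrac{\left(1+\frac{\gamma}{2\beta\varepsilon-\gamma}\right)\|z^0-z^\ast\|^2}{2\gamma\underline\lambda(k+1)}$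 and $\min_{i=0,\dots,k}q_i=o(1/(k+1))$. 3. (Ergodic, first averaging) If $(\lambda_j)\subseteq(0,1/\alpha]$, then $\dfrac1{\sum_{i=0}^k\lambda_i}\sum_{i=0}^k\lambda_iq_i\le\dfrac{\left(1+\frac{\gamma}{2\beta\varepsilon-\gamma}\right)\|z^0-z^\ast\|^2}{2\gamma\sum_{i=0}^k\lambda_i}$. 4. (Ergodic, second averaging) If $\lambda_j\equiv\lambda\in(0,1/\alpha]$, then $\dfrac2{(k+1)(k+2)}\sum_{i=0}^k(i+1)q_i\le\dfrac{\left(1+\frac{\gamma}{2\beta\varepsilon-\gamma}\right)\|z^0-z^\ast\|^2}{\gamma\lambda(k+1)}$.
   Context: $J_S:=(I_{\mathcal H}+S)^{-1}$. Convention: every monotone operator $S$ is regarded as $\mu_S$-strongly monotone ($\langle x-y,u-v\rangle\ge\mu_S\|x-y\|^2$ for $u\in Sx,v\in Sy$) and $\beta_S$-cocoercive ($\langle x-y,Sx-Sy\rangle\ge\beta_S\|Sx-Sy\|^2$, $S$ single-valued if $\beta_S>0$) with $\mu_S\ge0$, $\beta_S\ge0$, where the value $0$ means no assumption. Define $Q_S(x,y)=\max\{\mu_S\|x-y\|^2,\beta_S\|Sx-Sy\|^2\}$ (the second term is $0$ if $\beta_S=0$). If $S=\partial f$ for a proper closed convex $f$ that is $\mu$-strongly convex and, when $\beta_f>0$, differentiable with $(1/\beta_f)$-Lipschitz gradient ($\mu,\beta_f\ge0$, $0$ meaning no assumption), then instead $Q_S(x,y)=\max\left\{\beta_f\|\nabla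 f(x)-\nabla f(y)\|^2,\ \mu\|x-y\|^2,\ \frac{\mu}{\mu\beta_f+1}\|x-y\|^2+\frac{\beta_f}{\mu\beta_f+1}\|\nabla f(x)-\nabla f(y)\|^2\right\}$, terms with factor $\beta_f=0$ being $0$. *)

theory Defs
  imports "HOL-Analysis.Analysis" "HOL-Library.Landau_Symbols"
begin

text \<open>A set-valued operator on \<open>H\<close> is a function \<open>'a \<Rightarrow> 'a set\<close>; a single-valued operator \<open>C\<close> is
  identified with \<open>\<lambda>x. {C x}\<close>.\<close>

definition monotone_op :: "('a::real_inner \<Rightarrow> 'a set) \<Rightarrow> bool" where
  "monotone_op S \<longleftrightarrow> (\<forall>x y. \<forall>u\<in>S x. \<forall>v\<in>S y. 0 \<le> inner (x - y) (u - v))"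

definition maximal_monotone :: "('a::real_inner \<Rightarrow> 'a set) \<Rightarrow> bool" where
  "maximal_monotone S \<longleftrightarrow>
     monotone_op S \<and> (\<forall>S'. monotone_op S' \<and> (\<forall>x. S x \<subseteq> S' x) \<longrightarrow> S' = S)"

definition strongly_monotone :: "real \<Rightarrow> ('a::real_inner \<Rightarrow> 'a set) \<Rightarrow> bool" where
  "strongly_monotone \<mu> S \<longleftrightarrow>
     (\<forall>x y. \<forall>u\<in>S x. \<forall>v\<in>S y. \<mu> * (norm (x - y))\<^sup>2 \<le> inner (x - y) (u - v))"

text \<open>For \<open>\<beta> > 0\<close> the inequality with \<open>x = y\<close> forces \<open>S x\<close> to have at most one element.\<close>

definition cocoercive :: "real \<Rightarrow> ('a::real_inner \<Rightarrow> 'a set) \<Rightarrow> bool" where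
  "cocoercive \<beta> S \<longleftrightarrow>
     (\<forall>x y. \<forall>u\<in>S x. \<forall>v\<in>S y. \<beta> * (norm (u - v))\<^sup>2 \<le> inner (x - y) (u - v))"

definition scale_op :: "real \<Rightarrow> ('a::real_vector \<Rightarrow> 'a set) \<Rightarrow> 'a \<Rightarrow> 'a set" where
  "scale_op c S x = (\<lambda>u. c *\<^sub>R u) ` S x"

text \<open>\<open>(I + S)\<^sup>-\<^sup>1\<close>; for maximal monotone \<open>S\<close> on a Hilbert space it is single-valued with full domain,
  so the description operator picks its value.\<close>

definition resolvent :: "('a::real_vector \<Rightarrow> 'a set) \<Rightarrow> 'a \<Rightarrow> 'a" where
  "resolvent S z = (THE x. \<exists>u\<in>S x. z = x + u)"

definition epigraph_ereal :: "('a \<Rightarrow> ereal) \<Rightarrow> ('a \<times> real) set" where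
  "epigraph_ereal f = {(x, r). f x \<le> ereal r}"

definition proper_closed_convex :: "('a::real_normed_vector \<Rightarrow> ereal) \<Rightarrow> bool" where
  "proper_closed_convex f \<longleftrightarrow>
     (\<forall>x. f x \<noteq> -\<infinity>) \<and> (\<exists>x. f x \<noteq> \<infinity>) \<and> closed (epigraph_ereal f) \<and> convex (epigraph_ereal f)"

definition strongly_convex :: "real \<Rightarrow> ('a::real_normed_vector \<Rightarrow> ereal) \<Rightarrow> bool" where
  "strongly_convex \<mu> f \<longleftrightarrow> convex (epigraph_ereal (\<lambda>x. f x - ereal (\<mu> / 2 * (norm x)\<^sup>2)))"

definition subdifferential :: "('a::real_inner \<Rightarrow> ereal) \<Rightarrow> 'a \<Rightarrow> 'a set" where
  "subdifferential f x = {u. \<forall>y. f x + ereal (inner u (y - x)) \<le> f y}"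

definition grad :: "('a::real_inner \<Rightarrow> ereal) \<Rightarrow> 'a \<Rightarrow> 'a" where
  "grad f x = (THE D. GDERIV (\<lambda>y. real_of_ereal (f y)) x :> D)"

definition lipschitz_differentiable :: "real \<Rightarrow> ('a::real_inner \<Rightarrow> ereal) \<Rightarrow> bool" where
  "lipschitz_differentiable L f \<longleftrightarrow>
     (\<forall>x. \<bar>f x\<bar> \<noteq> \<infinity>) \<and>
     (\<forall>x. \<exists>D. GDERIV (\<lambda>y. real_of_ereal (f y)) x :> D) \<and>
     L-lipschitz_on UNIV (grad f)"

text \<open>In both of the following, \<open>the_elem\<close> and \<open>grad\<close> are only meaningful for \<open>\<beta> > 0\<close>; for \<open>\<beta> = 0\<close> the
  terms containing them vanish because of the factor \<open>\<beta>\<close>.\<close>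

definition Q_monotone ::
    "real \<Rightarrow> real \<Rightarrow> ('a::real_inner \<Rightarrow> 'a set) \<Rightarrow> 'a \<Rightarrow> 'a \<Rightarrow> real" where
  "Q_monotone \<mu> \<beta> S x y =
     max (\<mu> * (norm (x - y))\<^sup>2) (\<beta> * (norm (the_elem (S x) - the_elem (S y)))\<^sup>2)"

definition Q_subdifferential ::
    "real \<Rightarrow> real \<Rightarrow> ('a::real_inner \<Rightarrow> ereal) \<Rightarrow> 'a \<Rightarrow> 'a \<Rightarrow> real" where
  "Q_subdifferential \<mu> \<beta> f x y =
     Max {\<beta> * (norm (grad f x - grad f y))\<^sup>2,
          \<mu> * (norm (x - y))\<^sup>2,
          \<mu> / (\<mu> * \<beta> + 1) * (norm (x - y))\<^sup>2
            + \<beta> / (\<mu> * \<beta> + 1) * (norm (grad f x - grad f y))\<^sup>2}"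

text \<open>\<open>Q_function S Q\<close>: \<open>Q\<close> is the function \<open>Q\<^sub>S\<close> for some choice of regularity constants valid for
  the monotone operator \<open>S\<close>, where a constant \<open>0\<close> imposes nothing.\<close>

inductive Q_function ::
    "('a::real_inner \<Rightarrow> 'a set) \<Rightarrow> ('a \<Rightarrow> 'a \<Rightarrow> real) \<Rightarrow> bool" for S where
  monotone:
    "\<lbrakk>\<mu> \<ge> 0; \<beta> \<ge> 0; monotone_op S; \<mu> > 0 \<longrightarrow> strongly_monotone \<mu> S; \<beta> > 0 \<longrightarrow> cocoercive \<beta> S\<rbrakk>
     \<Longrightarrow> Q_function S (Q_monotone \<mu> \<beta> S)"
| subdifferential:
    "\<lbrakk>\<mu> \<ge> 0; \<beta> \<ge> 0; proper_closed_convex f; S = subdifferential f;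
      \<mu> > 0 \<longrightarrow> strongly_convex \<mu> f; \<beta> > 0 \<longrightarrow> lipschitz_differentiable (1 / \<beta>) f\<rbrakk>
     \<Longrightarrow> Q_function S (Q_subdifferential \<mu> \<beta> f)"

end

theory Submission
  imports Defs
begin

text \<open>Write \<open>w\<close> for the distance vector \<open>z\<^sup>k - z\<^sup>*\<close>, \<open>r = x\<^sub>B - x\<^sub>A\<close> for the residual \<open>(I - T) z\<^sup>k\<close>
  and \<open>c = C x\<^sub>B - C x\<^sup>*\<close>. The three monotonicity gaps at \<open>x\<^sub>A\<close>, \<open>x\<^sub>B\<close>, \<open>x\<^sub>B\<close> relative to \<open>x\<^sup>*\<close>
  dominate \<open>q\<^sub>k\<close> and add up to \<open>(\<langle>r, w\<rangle> - \<parallel>r\<parallel>\<^sup>2 + \<gamma> \<langle>r, c\<rangle>) / \<gamma>\<close>. The nonergodic rate follows by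
  Cauchy-Schwarz, because \<open>\<parallel>r\<parallel>\<^sup>2\<close> is nonincreasing and summable for an averaged operator. For the other
  rates the term \<open>2\<gamma> \<langle>r, c\<rangle> \<le> \<epsilon> \<parallel>r\<parallel>\<^sup>2 + (\<gamma>\<^sup>2 / \<epsilon>) \<parallel>c\<parallel>\<^sup>2\<close> is absorbed by the decrease of \<open>\<parallel>w\<parallel>\<^sup>2\<close>, which
  controls \<open>\<lambda>\<^sub>k \<parallel>c\<parallel>\<^sup>2\<close> thanks to the cocoercivity of \<open>C\<close>; the resulting bound on \<open>\<lambda>\<^sub>k q\<^sub>k\<close> telescopes.\<close>

section \<open>Minty's theorem and resolvents\<close>

text \<open>This yields first-order conditions: comparing values along a segment and dividing by
  \<open>s\<close> leaves an inequality affine in \<open>s\<close>, and \<open>s\<close> tends to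
  0.\<close>

lemma affine_nonneg_at_zero:
  fixes a b :: real
  assumes "\<And>s. 0 < s \<Longrightarrow> s < 1 \<Longrightarrow> 0 \<le> a + s * b"
  shows "0 \<le> a"
proof (rule tendsto_lowerbound)
  show "((\<lambda>s. a + s * b) \<longlongrightarrow> a) (at_right 0)"
    by (auto intro!: tendsto_eq_intros)
  show "\<forall>\<^sub>F s in at_right 0. 0 \<le> a + s * b"
    using eventually_at_right_real[of 0 1] by (auto elim!: eventually_mono intro: assms)
qed simp

lemma norm_add_squared:
  fixes x y :: "'a::real_inner"
  shows "(norm (x + y))\<^sup>2 = (norm x)\<^sup>2 + 2 * inner x y + (norm y)\<^sup>2"
  by (simp add: power2_norm_eq_inner algebra_simps inner_commute)

lemma norm_diff_squared:
  fixes x y :: "'a::real_inner"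
  shows "(norm (x - y))\<^sup>2 = (norm x)\<^sup>2 - 2 * inner x y + (norm y)\<^sup>2"
  by (simp add: power2_norm_eq_inner algebra_simps inner_commute)

text \<open>The objective is strongly convex in \<open>w\<close>, so the first components of a
  minimizing sequence are Cauchy. Working with an epigraph covers lower semicontinuous convex
  functions with infinite values.\<close>

lemma exists_epigraph_minimizer:
  fixes E :: "('w::{real_inner, complete_space} \<times> real) set"
  assumes "closed E" "convex E" "E \<noteq> {}"
    and bound: "\<And>w t. (w, t) \<in> E \<Longrightarrow> 0 \<le> t + (norm w)\<^sup>2 / 2"
  obtains w t where "(w, t) \<in> E"
    "\<And>w' t'. (w', t') \<in> E \<Longrightarrow> t + (norm w)\<^sup>2 / 2 \<le> t' + (norm w')\<^sup>2 / 2"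
proof -
  define F where "F = (\<lambda>p::'w \<times> real. snd p + (norm (fst p))\<^sup>2 / 2)"
  define m where "m = Inf (F ` E)"
  have bdd: "bdd_below (F ` E)"
    using bound by (intro bdd_belowI[of _ 0]) (auto simp: F_def)
  have m_le: "m \<le> F p" if "p \<in> E" for p
    unfolding m_def using that bdd by (intro cInf_lower) auto
  have "\<exists>p\<in>E. F p < m + 1 / real (Suc n)" for n
    using cInf_lessD[of "F ` E" "m + 1 / real (Suc n)"] \<open>E \<noteq> {}\<close> by (auto simp: m_def)
  then obtain p where p: "\<And>n. p n \<in> E" "\<And>n. F (p n) < m + 1 / real (Suc n)"
    by metis
  \<comment> \<open>Parallelogram law: the midpoint lies in \<open>E\<close> and has value at least
    \<open>m\<close>, so a quarter of the squared distance is at most the sum of the two excesses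
    over \<open>m\<close>.\<close>
  have close: "(norm (fst (p i) - fst (p j)))\<^sup>2 \<le> 4 * (1 / real (Suc i) + 1 / real (Suc j))" for i j
  proof -
    have "(1/2) *\<^sub>R p i + (1/2) *\<^sub>R p j \<in> E"
      using p(1) by (intro convexD[OF \<open>convex E\<close>]) auto
    from m_le[OF this]
    have "m \<le> (snd (p i) + snd (p j)) / 2 + (norm ((1/2) *\<^sub>R (fst (p i) + fst (p j))))\<^sup>2 / 2"
      by (simp add: F_def scaleR_add_right add_divide_distrib)
    then have "m \<le> (snd (p i) + snd (p j)) / 2 + (norm (fst (p i) + fst (p j)))\<^sup>2 / 8"
      by (simp add: power_mult_distrib power2_eq_square)
    moreover have "a + b - 2 * c \<le> 4 * (d + e)"
      if "x + a / 2 < m + d" "y + b / 2 < m + e" "m \<le> (x + y) / 2 + (a + 2 * c + b) / 8"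
      for a b c d e x y :: real
      using that by argo
    ultimately show ?thesis
      using p(2)[of i] p(2)[of j] unfolding F_def norm_add_squared norm_diff_squared by force
  qed
  have "Cauchy (\<lambda>n. fst (p n))"
  proof (rule metric_CauchyI)
    fix e :: real assume "e > 0"
    \<comment> \<open>\<open>close\<close> adds two excesses and multiplies by 4, hence the
      8.\<close>
    then obtain N where N: "1 / real (Suc N) < e\<^sup>2 / 8"
      using nat_approx_posE[of "e\<^sup>2 / 8"] by auto
    have "dist (fst (p i)) (fst (p j)) < e" if "i \<ge> N" "j \<ge> N" for i j
    proof -
      have *: "1 / real (Suc k) \<le> 1 / real (Suc N)" if "k \<ge> N" for k
        using that by (simp add: frac_le)
      have "(norm (fst (p i) - fst (p j)))\<^sup>2 < e\<^sup>2"
        using close[of i j] *[of i] *[of j] that N by simp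
      then show ?thesis
        using \<open>e > 0\<close> by (simp add: dist_norm power_less_imp_less_base)
    qed
    then show "\<exists>N. \<forall>i\<ge>N. \<forall>j\<ge>N. dist (fst (p i)) (fst (p j)) < e" by blast
  qed
  then obtain w where w: "(\<lambda>n. fst (p n)) \<longlonglongrightarrow> w"
    using Cauchy_convergent convergent_def by blast
  have "(\<lambda>n. m + 1 / real (Suc n)) \<longlonglongrightarrow> m + 0"
    by (intro tendsto_intros LIMSEQ_Suc[OF lim_1_over_n])
  then have lim: "(\<lambda>n. m + 1 / real (Suc n)) \<longlonglongrightarrow> m" by simp
  have Fp: "(\<lambda>n. F (p n)) \<longlonglongrightarrow> m"
    by (rule tendsto_sandwich[OF _ _ tendsto_const lim])
       (use m_le[OF p(1)] p(2) in \<open>simp_all add: less_imp_le del: of_nat_Suc\<close>)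
  \<comment> \<open>The heights converge because both the values and the quadratic parts do.\<close>
  have "(\<lambda>n. F (p n) - (norm (fst (p n)))\<^sup>2 / 2) \<longlonglongrightarrow> m - (norm w)\<^sup>2 / 2"
    by (intro tendsto_intros Fp w) simp
  then have "(\<lambda>n. snd (p n)) \<longlonglongrightarrow> m - (norm w)\<^sup>2 / 2"
    by (simp add: F_def)
  from tendsto_Pair[OF w this] have "p \<longlonglongrightarrow> (w, m - (norm w)\<^sup>2 / 2)"
    by simp
  with p(1) \<open>closed E\<close> have "(w, m - (norm w)\<^sup>2 / 2) \<in> E"
    using closed_sequentially by blast
  then show ?thesis
    using m_le that[of w "m - (norm w)\<^sup>2 / 2"] by (fastforce simp: F_def)
qed

text \<open>At a minimizer the one-sided derivative of the objective towards any other point of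
  \<open>E\<close> is nonnegative.\<close>

lemma exists_epigraph_stationary_point:
  fixes E :: "('w::{real_inner, complete_space} \<times> real) set"
  assumes "closed E" "convex E" "E \<noteq> {}"
    and bound: "\<And>w t. (w, t) \<in> E \<Longrightarrow> 0 \<le> t + (norm w)\<^sup>2 / 2"
  obtains w t where "(w, t) \<in> E"
    "\<And>w' t'. (w', t') \<in> E \<Longrightarrow> t \<le> t' + inner w (w' - w)"
proof -
  obtain w t where wt: "(w, t) \<in> E"
    and min: "\<And>w' t'. (w', t') \<in> E \<Longrightarrow> t + (norm w)\<^sup>2 / 2 \<le> t' + (norm w')\<^sup>2 / 2"
    using exists_epigraph_minimizer[OF assms] by blast
  have "t \<le> t' + inner w (w' - w)" if "(w', t') \<in> E" for w' t'
  proof -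
    have "0 \<le> (t' - t + inner w (w' - w)) + s * ((norm (w' - w))\<^sup>2 / 2)" if s: "0 < s" "s < 1" for s
    proof -
      have "(1 - s) *\<^sub>R (w, t) + s *\<^sub>R (w', t') \<in> E"
        using s by (intro convexD[OF \<open>convex E\<close> wt \<open>(w', t') \<in> E\<close>]) auto
      also have "(1 - s) *\<^sub>R (w, t) + s *\<^sub>R (w', t') = (w + s *\<^sub>R (w' - w), t + s * (t' - t))"
        by (simp add: algebra_simps)
      finally have "0 \<le> s * ((t' - t + inner w (w' - w)) + s * ((norm (w' - w))\<^sup>2 / 2))"
        using min[of "w + s *\<^sub>R (w' - w)" "t + s * (t' - t)"]
        unfolding norm_add_squared[of w] norm_scaleR inner_scaleR_right power_mult_distrib power2_abs
        by (simp add: power2_eq_square distrib_left) argo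
      then show ?thesis using s by (simp add: zero_le_mult_iff)
    qed
    then have "0 \<le> t' - t + inner w (w' - w)"
      by (rule affine_nonneg_at_zero)
    then show ?thesis by simp
  qed
  with wt show ?thesis using that by blast
qed

text \<open>\<open>E\<close> is the epigraph of the Fitzpatrick function \<open>\<phi>\<close>, and the stationarity
  condition for \<open>\<phi> + \<parallel>\<cdot>\<parallel>\<^sup>2/2\<close> at \<open>(x, u)\<close> says that \<open>(- u, - x)\<close> is monotonically related to \<open>G\<close>
  with a gap of \<open>\<parallel>x + u\<parallel>\<^sup>2\<close>.\<close>

lemma maximal_monotone_graph_meets_antidiagonal:
  fixes G :: "('a::{real_inner, complete_space} \<times> 'a) set"
  assumes mono: "\<And>x u y v. (x, u) \<in> G \<Longrightarrow> (y, v) \<in> G \<Longrightarrow> 0 \<le> inner (x - y) (u - v)"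
    and maximal: "\<And>x u. (\<And>y v. (y, v) \<in> G \<Longrightarrow> 0 \<le> inner (x - y) (u - v)) \<Longrightarrow> (x, u) \<in> G"
  shows "\<exists>x. (x, - x) \<in> G"
proof -
  \<comment> \<open>There is one half-space per graph point. \<open>prod.swap\<close> makes the
    inner product on pairs match \<open>x\<close> with \<open>v\<close> and \<open>u\<close> with
    \<open>y\<close>.\<close>
  define E where
    "E = (\<Inter>p\<in>G. {w::('a \<times> 'a) \<times> real. inner (fst w) (prod.swap p) - inner (fst p) (snd p) \<le> snd w})"
  have E: "((x, u), t) \<in> E \<longleftrightarrow> (\<forall>(y, v)\<in>G. inner x v + inner y u - inner y v \<le> t)" for x u t
    by (auto simp: E_def inner_commute)
  have "closed E"
    unfolding E_def by (intro closed_INT ballI closed_Collect_le continuous_intros)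
  have "convex E"
  proof (rule convexI)
    fix w w' :: "('a \<times> 'a) \<times> real" and a b :: real
    assume ww: "w \<in> E" "w' \<in> E" and ab: "0 \<le> a" "0 \<le> b" "a + b = 1"
    have "inner (fst (a *\<^sub>R w + b *\<^sub>R w')) (prod.swap p) - inner (fst p) (snd p)
        \<le> snd (a *\<^sub>R w + b *\<^sub>R w')" if "p \<in> G" for p
    proof -
      have "a * (inner (fst w) (prod.swap p) - inner (fst p) (snd p))
          + b * (inner (fst w') (prod.swap p) - inner (fst p) (snd p)) \<le> a * snd w + b * snd w'"
        using ww ab that by (intro add_mono mult_left_mono) (auto simp: E_def)
      moreover have "a * inner (fst p) (snd p) + b * inner (fst p) (snd p) = inner (fst p) (snd p)"
        using ab by (simp flip: distrib_right)
      ultimately show ?thesis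
        by (simp add: inner_add_left right_diff_distrib)
    qed
    then show "a *\<^sub>R w + b *\<^sub>R w' \<in> E" by (simp add: E_def)
  qed
  have graph_E: "((y, v), inner y v) \<in> E" if "(y, v) \<in> G" for y v
    unfolding E using mono[OF that] by (auto simp: algebra_simps inner_commute)
  \<comment> \<open>For empty \<open>G\<close> the premise of \<open>maximal\<close> would hold
    vacuously at the origin.\<close>
  have "G \<noteq> {}" using maximal[of 0 0] by auto
  then have "E \<noteq> {}" using graph_E by fastforce
  \<comment> \<open>If \<open>t\<close> were smaller, the constraints of \<open>E\<close> would
    relate \<open>(x, u)\<close> monotonically to all of \<open>G\<close>. By maximality
    \<open>(x, u)\<close> would lie in \<open>G\<close>, and its own constraint is the desired
    bound.\<close>
  have ge_inner: "inner x u \<le> t" if "((x, u), t) \<in> E" for x u t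
  proof (rule ccontr)
    assume "\<not> inner x u \<le> t"
    then have "0 \<le> inner (x - y) (u - v)" if "(y, v) \<in> G" for y v
      using that \<open>((x, u), t) \<in> E\<close> by (fastforce simp: E algebra_simps inner_commute)
    then have "(x, u) \<in> G" by (rule maximal)
    with \<open>\<not> inner x u \<le> t\<close> \<open>((x, u), t) \<in> E\<close> show False by (auto simp: E)
  qed
  \<comment> \<open>By \<open>ge_inner\<close> the left-hand objective is at least half the squared
    norm of \<open>x + u\<close>.\<close>
  have "0 \<le> t + (norm w)\<^sup>2 / 2" if "(w, t) \<in> E" for w t
  proof -
    obtain x u where w: "w = (x, u)" by (cases w)
    have "(norm w)\<^sup>2 = (norm x)\<^sup>2 + (norm u)\<^sup>2"
      by (simp add: w norm_Pair)
    then show ?thesis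
      using ge_inner[of x u t] that norm_add_squared[of x u] zero_le_power2[of "norm (x + u)"]
      unfolding w by linarith
  qed
  then obtain w t where wt: "(w, t) \<in> E"
    and opt: "\<And>w' t'. (w', t') \<in> E \<Longrightarrow> t \<le> t' + inner w (w' - w)"
    using exists_epigraph_stationary_point[OF \<open>closed E\<close> \<open>convex E\<close> \<open>E \<noteq> {}\<close>] by blast
  obtain x u where w: "w = (x, u)" by (cases w)
  \<comment> \<open>Stationarity is tested at the graph points, whose height is the pairing itself;
    \<open>t\<close> is then replaced by its lower bound \<open>inner x u\<close>, which completes
    the square.\<close>
  have gap: "(norm (x + u))\<^sup>2 \<le> inner (- u - y) (- x - v)" if "(y, v) \<in> G" for y v
    using opt[OF graph_E[OF that]] ge_inner[of x u t] wt
    by (simp add: w power2_norm_eq_inner algebra_simps inner_commute)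
  have in_G: "(- u, - x) \<in> G"
    by (rule maximal) (use gap zero_le_power2 order_trans in blast)
  \<comment> \<open>For the pair \<open>(- u, - x)\<close> itself the right-hand side of
    \<open>gap\<close> is 0.\<close>
  from gap[OF this] have "x + u = 0" by simp
  with in_G show ?thesis by (metis add_eq_0_iff minus_minus)
qed

text \<open>Adjoining the pair to the graph gives a monotone extension, which maximality forces to
  be \<open>S\<close> itself.\<close>

lemma maximal_monotoneD_related:
  assumes "maximal_monotone S" and "\<And>y v. v \<in> S y \<Longrightarrow> 0 \<le> inner (x - y) (u - v)"
  shows "u \<in> S x"
proof -
  define S' where "S' = S(x := insert u (S x))"
  have sym: "0 \<le> inner (y - x) (v - u)" if "v \<in> S y" for y v
    using assms(2)[OF that] by (simp add: algebra_simps)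
  have "monotone_op S'"
    using assms sym by (auto simp: S'_def monotone_op_def maximal_monotone_def)
  then have "S' = S"
    using assms(1) by (auto simp: maximal_monotone_def S'_def)
  then show ?thesis by (metis S'_def fun_upd_same insertI1)
qed

text \<open>Minty's argument gives existence and monotonicity gives uniqueness, so the description
  operator in \<open>resolvent\<close> picks a genuine solution.\<close>

lemma resolvent_solves:
  fixes S :: "'a::{real_inner, complete_space} \<Rightarrow> 'a set"
  assumes S: "maximal_monotone S" and "\<gamma> > 0"
  shows "\<exists>u\<in>S (resolvent (scale_op \<gamma> S) z). z = resolvent (scale_op \<gamma> S) z + \<gamma> *\<^sub>R u"
proof -
  have mono: "0 \<le> inner (x - y) (u - v)" if "u \<in> S x" "v \<in> S y" for x y u v
    using S that by (auto simp: maximal_monotone_def monotone_op_def)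
  have solvable: "\<exists>x. \<exists>u\<in>S x. z = x + \<gamma> *\<^sub>R u"
  proof -
    \<comment> \<open>This is the graph of the scaled operator shifted by \<open>- z\<close>;
      meeting the antidiagonal at \<open>x\<close> means solving the resolvent equation.\<close>
    define G where "G = {(x, w). (1 / \<gamma>) *\<^sub>R (w + z) \<in> S x}"
    have scale: "inner d (w - v) = \<gamma> * inner d ((1 / \<gamma>) *\<^sub>R (w + z) - (1 / \<gamma>) *\<^sub>R (v + z))" for d w v
      using \<open>\<gamma> > 0\<close> by (simp flip: scaleR_diff_right)
    have "\<exists>x. (x, - x) \<in> G"
    proof (rule maximal_monotone_graph_meets_antidiagonal)
      fix x u y v assume "(x, u) \<in> G" "(y, v) \<in> G"
      then show "0 \<le> inner (x - y) (u - v)"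
        unfolding scale[of _ u] using mono \<open>\<gamma> > 0\<close> by (simp add: G_def)
    next
      fix x u assume related: "\<And>y v. (y, v) \<in> G \<Longrightarrow> 0 \<le> inner (x - y) (u - v)"
      have "0 \<le> inner (x - y) ((1 / \<gamma>) *\<^sub>R (u + z) - v)" if "v \<in> S y" for y v
        using related[of y "\<gamma> *\<^sub>R v - z"] \<open>\<gamma> > 0\<close> that
        unfolding scale[of _ u] by (simp add: G_def zero_le_mult_iff)
      then show "(x, u) \<in> G"
        unfolding G_def using maximal_monotoneD_related[OF S] by blast
    qed
    then obtain x where "(1 / \<gamma>) *\<^sub>R (- x + z) \<in> S x" by (auto simp: G_def)
    then show ?thesis using \<open>\<gamma> > 0\<close> by (intro exI[of _ x] bexI) auto
  qed
  have unique: "x = y" if "u \<in> S x" "v \<in> S y" "x + \<gamma> *\<^sub>R u = y + \<gamma> *\<^sub>R v" for x y u v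
  proof -
    have "x - y = - (\<gamma> *\<^sub>R (u - v))"
      using that(3) by (simp add: algebra_simps)
    then have "inner (x - y) (x - y) = - (\<gamma> * inner (x - y) (u - v))"
      by (metis inner_minus_right inner_scaleR_right)
    moreover have "0 \<le> \<gamma> * inner (x - y) (u - v)"
      using mono[OF that(1,2)] \<open>\<gamma> > 0\<close> by simp
    ultimately have "(norm (x - y))\<^sup>2 \<le> 0" by (simp add: power2_norm_eq_inner)
    then show ?thesis by simp
  qed
  have "\<exists>u\<in>scale_op \<gamma> S (resolvent (scale_op \<gamma> S) z). z = resolvent (scale_op \<gamma> S) z + u"
    unfolding resolvent_def
  proof (rule theI'[where P = "\<lambda>x. \<exists>u\<in>scale_op \<gamma> S x. z = x + u"])
    show "\<exists>!x. \<exists>u\<in>scale_op \<gamma> S x. z = x + u"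
      unfolding scale_op_def bex_simps using solvable unique by (intro ex_ex1I) blast+
  qed
  then show ?thesis by (auto simp: scale_op_def)
qed

section \<open>Regularity of subdifferentials\<close>

lemma descent_lemma:
  fixes f :: "'a::real_inner \<Rightarrow> real"
  assumes deriv: "\<And>x. GDERIV f x :> g x"
    and lipschitz: "\<And>x y. norm (g x - g y) \<le> L * norm (x - y)"
  shows "f y \<le> f x + inner (g x) (y - x) + L / 2 * (norm (y - x))\<^sup>2"
proof -
  define d where "d = y - x"
  \<comment> \<open>The claim says that the difference between \<open>f\<close> and its model does
    not increase from \<open>x\<close> to \<open>y\<close>; its derivative is controlled by
    Cauchy-Schwarz and the Lipschitz bound.\<close>
  define \<phi> where
    "\<phi> = (\<lambda>t. f (x + t *\<^sub>R d) - t * inner (g x) d - L / 2 * t\<^sup>2 * (norm d)\<^sup>2)"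
  have "\<phi> 1 \<le> \<phi> 0"
  proof (rule DERIV_nonpos_imp_nonincreasing[of 0 1 \<phi>])
    fix t :: real assume t: "0 \<le> t" "t \<le> 1"
    have "(f has_derivative (\<lambda>h. inner h (g (x + t *\<^sub>R d)))) (at (x + t *\<^sub>R d))"
      using deriv by (simp add: gderiv_def)
    then have "((\<lambda>t. f (x + t *\<^sub>R d)) has_derivative (\<lambda>s. inner (s *\<^sub>R d) (g (x + t *\<^sub>R d)))) (at t)"
      by (rule has_derivative_compose[rotated]) (auto intro!: derivative_eq_intros)
    then have f': "((\<lambda>t. f (x + t *\<^sub>R d)) has_real_derivative inner d (g (x + t *\<^sub>R d))) (at t)"
      by (simp add: has_field_derivative_def mult_commute_abs)
    have "(\<phi> has_real_derivative
        inner d (g (x + t *\<^sub>R d)) - inner (g x) d - L * t * (norm d)\<^sup>2) (at t)"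
      unfolding \<phi>_def by (rule derivative_eq_intros f' refl | simp)+
    moreover have "inner d (g (x + t *\<^sub>R d)) - inner (g x) d \<le> norm d * (L * norm (t *\<^sub>R d))"
    proof -
      have "inner d (g (x + t *\<^sub>R d)) - inner (g x) d = inner d (g (x + t *\<^sub>R d) - g x)"
        by (simp add: inner_diff_right inner_commute)
      also have "\<dots> \<le> norm d * norm (g (x + t *\<^sub>R d) - g x)"
        by (rule norm_cauchy_schwarz)
      also have "\<dots> \<le> norm d * (L * norm (t *\<^sub>R d))"
        using lipschitz[of "x + t *\<^sub>R d" x] by (intro mult_left_mono) auto
      finally show ?thesis .
    qed
    ultimately show "\<exists>y. (\<phi> has_real_derivative y) (at t) \<and> y \<le> 0"
      using t by (auto simp: power2_eq_square algebra_simps)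
  qed simp
  then show ?thesis by (simp add: \<phi>_def d_def)
qed

text \<open>Tilting \<open>f\<close> by the subgradient makes \<open>x\<close> a global minimizer,
  where the derivative must vanish.\<close>

lemma GDERIV_subgradient_eq:
  fixes f :: "'a::real_inner \<Rightarrow> real"
  assumes deriv: "GDERIV f x :> D" and sub: "\<And>y. f x + inner u (y - x) \<le> f y"
  shows "u = D"
proof -
  define \<phi> where "\<phi> = (\<lambda>y. f y - inner (y - x) u)"
  have "(f has_derivative (\<lambda>h. inner h D)) (at x)"
    using deriv by (simp add: gderiv_def)
  then have "(\<phi> has_derivative (\<lambda>h. inner h D - inner h u)) (at x)"
    unfolding \<phi>_def by (auto intro!: derivative_eq_intros)
  moreover have "\<phi> x \<le> \<phi> y" for y
    using sub[of y] by (simp add: \<phi>_def inner_commute)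
  ultimately have "(\<lambda>h. inner h D - inner h u) = (\<lambda>h. 0)"
    by (intro differential_zero_maxmin[of x UNIV \<phi>]) auto
  then have "inner (D - u) D - inner (D - u) u = 0" by metis
  then have "inner (D - u) (D - u) = 0" by (simp add: inner_diff_right)
  then show ?thesis by simp
qed

text \<open>The argument of Baillon and Haddad: the point \<open>w\<close> below minimizes the quadratic upper
  model of the convex function \<open>f - \<mu>/2 \<parallel>\<cdot>\<parallel>\<^sup>2\<close> around \<open>y\<close>, tilted by the gradient at \<open>x\<close>.\<close>

lemma strongly_convex_smooth_gap:
  fixes f :: "'a::real_inner \<Rightarrow> real"
  assumes lower: "\<And>w. f x + inner u (w - x) + \<mu> / 2 * (norm (w - x))\<^sup>2 \<le> f w"
    and upper: "\<And>w. f w \<le> f y + inner v (w - y) + L / 2 * (norm (w - y))\<^sup>2"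
    and "\<mu> < L"
  shows "f x + inner u (y - x) + \<mu> / 2 * (norm (y - x))\<^sup>2
    + (norm ((v - u) - \<mu> *\<^sub>R (y - x)))\<^sup>2 / (2 * (L - \<mu>)) \<le> f y"
proof -
  define k where "k = (v - u) - \<mu> *\<^sub>R (y - x)"
  \<comment> \<open>The tilted model has curvature \<open>L - \<mu>\<close> and gradient
    \<open>k\<close> at \<open>y\<close>, so a step of length \<open>s\<close> reaches its
    minimizer.\<close>
  define s where "s = 1 / (L - \<mu>)"
  define w where "w = y - s *\<^sub>R k"
  have wx: "w - x = (y - x) - s *\<^sub>R k" and wy: "w - y = - (s *\<^sub>R k)" by (simp_all add: w_def)
  have v: "v = k + u + \<mu> *\<^sub>R (y - x)" by (simp add: k_def)
  have "f x + inner u (w - x) + \<mu> / 2 * (norm (w - x))\<^sup>2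
      \<le> f y + inner v (w - y) + L / 2 * (norm (w - y))\<^sup>2"
    using lower[of w] upper[of w] by linarith
  then have "f x + inner u (y - x) + \<mu> / 2 * (norm (y - x))\<^sup>2
      + (s - (L - \<mu>) / 2 * s\<^sup>2) * (norm k)\<^sup>2 \<le> f y"
    unfolding wx wy norm_diff_squared[of "y - x"] norm_minus_cancel
    unfolding v inner_diff_right[of u] inner_minus_right inner_scaleR_right inner_add_left
      inner_scaleR_left power_mult_distrib norm_scaleR power2_abs inner_commute[of "y - x" k]
      power2_norm_eq_inner[of k, symmetric]
    by (simp add: field_simps)
  moreover have "s - (L - \<mu>) / 2 * s\<^sup>2 = 1 / (2 * (L - \<mu>))"
    using \<open>\<mu> < L\<close> by (simp add: s_def power2_eq_square divide_simps)
  ultimately show ?thesis by (simp add: k_def)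
qed

text \<open>For \<open>\<mu> < L\<close> the gap inequality is added to its copy with
  \<open>x\<close> and \<open>y\<close> exchanged. Otherwise strong monotonicity together with the
  Lipschitz bound suffices.\<close>

lemma strongly_convex_smooth_cocoercive:
  fixes f :: "'a::real_inner \<Rightarrow> real"
  assumes lower_x: "\<And>w. f x + inner u (w - x) + \<mu> / 2 * (norm (w - x))\<^sup>2 \<le> f w"
    and lower_y: "\<And>w. f y + inner v (w - y) + \<mu> / 2 * (norm (w - y))\<^sup>2 \<le> f w"
    and upper_x: "\<And>w. f w \<le> f x + inner u (w - x) + L / 2 * (norm (w - x))\<^sup>2"
    and upper_y: "\<And>w. f w \<le> f y + inner v (w - y) + L / 2 * (norm (w - y))\<^sup>2"
    and lipschitz: "norm (u - v) \<le> L * norm (x - y)" and "0 \<le> \<mu>"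
  shows "(norm (u - v))\<^sup>2 + \<mu> * L * (norm (x - y))\<^sup>2 \<le> (L + \<mu>) * inner (x - y) (u - v)"
proof (cases "\<mu> < L")
  case True
  define d e where "d = x - y" and "e = u - v"
  have flip: "y - x = - d" "v - u = - e" "(- e) - \<mu> *\<^sub>R (- d) = - (e - \<mu> *\<^sub>R d)"
    by (simp_all add: d_def e_def algebra_simps)
  define S where "S = (norm (e - \<mu> *\<^sub>R d))\<^sup>2 / (2 * (L - \<mu>))"
  have "f x + inner u (- d) + \<mu> / 2 * (norm d)\<^sup>2 + S \<le> f y"
    using strongly_convex_smooth_gap[OF lower_x upper_y True]
    unfolding flip norm_minus_cancel S_def .
  moreover have "f y + inner v d + \<mu> / 2 * (norm d)\<^sup>2 + S \<le> f x"
    using strongly_convex_smooth_gap[OF lower_y upper_x True]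
    unfolding flip norm_minus_cancel S_def d_def[symmetric] e_def[symmetric] .
  ultimately have "\<mu> * (norm d)\<^sup>2 + 2 * S \<le> inner d e"
    by (simp add: e_def inner_diff_right inner_commute)
  then have "(L - \<mu>) * (\<mu> * (norm d)\<^sup>2 + 2 * S) \<le> (L - \<mu>) * inner d e"
    using True by (intro mult_left_mono) auto
  moreover have "(L - \<mu>) * (2 * S) = (norm (e - \<mu> *\<^sub>R d))\<^sup>2"
    using True by (simp add: S_def field_simps)
  ultimately have "(norm e)\<^sup>2 + \<mu> * L * (norm d)\<^sup>2 \<le> (L + \<mu>) * inner d e"
    unfolding norm_diff_squared[of e]
    by (simp add: power_mult_distrib algebra_simps inner_commute power2_eq_square[of \<mu>])
  then show ?thesis by (simp add: d_def e_def)
next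
  case False
  have "\<mu> * (norm (x - y))\<^sup>2 \<le> inner (x - y) (u - v)"
    using lower_x[of y] lower_y[of x]
    by (simp add: norm_minus_commute inner_diff_left inner_diff_right inner_commute)
  \<comment> \<open>The Lipschitz bound determines the sign of \<open>L\<close> only when the points
    differ; when they coincide both sides of the next inequality are 0.\<close>
  moreover have "0 \<le> L + \<mu>" if "x \<noteq> y"
    using order_trans[OF norm_ge_zero lipschitz] that \<open>0 \<le> \<mu>\<close> by (simp add: zero_le_mult_iff)
  ultimately have "(L + \<mu>) * (\<mu> * (norm (x - y))\<^sup>2) \<le> (L + \<mu>) * inner (x - y) (u - v)"
    by (cases "x = y") (auto intro!: mult_left_mono)
  moreover have "(norm (u - v))\<^sup>2 \<le> \<mu>\<^sup>2 * (norm (x - y))\<^sup>2"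
  proof -
    have "norm (u - v) \<le> \<mu> * norm (x - y)"
      using lipschitz False by (meson mult_right_mono norm_ge_zero not_less order_trans)
    then show ?thesis by (metis norm_ge_zero power_mono power_mult_distrib)
  qed
  ultimately show ?thesis by (simp add: algebra_simps power2_eq_square)
qed

lemma subdifferential_finite:
  assumes "proper_closed_convex f" "u \<in> subdifferential f x"
  shows "\<bar>f x\<bar> \<noteq> \<infinity>"
proof -
  obtain y where y: "f y \<noteq> \<infinity>" using assms(1) by (auto simp: proper_closed_convex_def)
  have "f x + ereal (inner u (y - x)) \<le> f y" using assms(2) by (simp add: subdifferential_def)
  then have "f x \<noteq> \<infinity>" using y by auto
  moreover have "f x \<noteq> - \<infinity>" using assms(1) by (auto simp: proper_closed_convex_def)
  ultimately show ?thesis by auto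
qed

text \<open>The subgradient inequality at an intermediate point is combined with convexity of
  \<open>f\<close> minus the quadratic; dividing by \<open>s\<close> and letting it tend to 0
  recovers the full quadratic term.\<close>

lemma strongly_convex_subgradient_ge:
  fixes f :: "'a::real_inner \<Rightarrow> ereal"
  assumes convex: "\<mu> > 0 \<longrightarrow> strongly_convex \<mu> f" and "\<mu> \<ge> 0" and sub: "u \<in> subdifferential f x"
    and fx: "f x = ereal rx" and fy: "f y = ereal ry"
  shows "rx + inner u (y - x) + \<mu> / 2 * (norm (y - x))\<^sup>2 \<le> ry"
proof (cases "\<mu> = 0")
  case True
  have "f x + ereal (inner u (y - x)) \<le> f y" using sub by (simp add: subdifferential_def)
  then show ?thesis using True by (simp add: fx fy)
next
  case False
  define d where "d = y - x"
  define E where "E = epigraph_ereal (\<lambda>x. f x - ereal (\<mu> / 2 * (norm x)\<^sup>2))"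
  have "convex E" using assms False by (simp add: strongly_convex_def E_def)
  have "0 \<le> (ry - rx - inner u d - \<mu> / 2 * (norm d)\<^sup>2) + s * (\<mu> / 2 * (norm d)\<^sup>2)"
    if s: "0 < s" "s < 1" for s
  proof -
    define p where "p = x + s *\<^sub>R d"
    define r where "r = (1 - s) * (rx - \<mu> / 2 * (norm x)\<^sup>2) + s * (ry - \<mu> / 2 * (norm y)\<^sup>2)"
    have "(1 - s) *\<^sub>R (x, rx - \<mu> / 2 * (norm x)\<^sup>2) + s *\<^sub>R (y, ry - \<mu> / 2 * (norm y)\<^sup>2) \<in> E"
      using s by (intro convexD[OF \<open>convex E\<close>]) (auto simp: E_def epigraph_ereal_def fx fy)
    also have "(1 - s) *\<^sub>R (x, rx - \<mu> / 2 * (norm x)\<^sup>2) + s *\<^sub>R (y, ry - \<mu> / 2 * (norm y)\<^sup>2) = (p, r)"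
      by (simp add: p_def r_def d_def algebra_simps)
    finally have "f p - ereal (\<mu> / 2 * (norm p)\<^sup>2) \<le> ereal r"
      by (simp add: E_def epigraph_ereal_def)
    moreover have "ereal rx + ereal (inner u (p - x)) \<le> f p"
      using sub by (simp add: subdifferential_def flip: fx)
    ultimately have "rx + inner u (p - x) - \<mu> / 2 * (norm p)\<^sup>2 \<le> r"
      by (cases "f p") auto
    moreover have "inner u (p - x) = s * inner u d" by (simp add: p_def)
    moreover have p2: "(norm p)\<^sup>2 = (norm x)\<^sup>2 + 2 * (s * inner x d) + s\<^sup>2 * (norm d)\<^sup>2"
      by (simp add: p_def norm_add_squared power_mult_distrib)
    moreover have y2: "(norm y)\<^sup>2 = (norm x)\<^sup>2 + 2 * inner x d + (norm d)\<^sup>2"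
      using norm_add_squared[of x d] by (simp add: d_def)
    ultimately have
      "0 \<le> s * ((ry - rx - inner u d - \<mu> / 2 * (norm d)\<^sup>2) + s * (\<mu> / 2 * (norm d)\<^sup>2))"
      unfolding r_def p2 y2 by (simp add: field_simps power2_eq_square[of s])
    then show ?thesis using s by (simp add: zero_le_mult_iff)
  qed
  then have "0 \<le> ry - rx - inner u d - \<mu> / 2 * (norm d)\<^sup>2"
    by (rule affine_nonneg_at_zero)
  then show ?thesis by (simp add: d_def)
qed

lemma GDERIV_grad:
  assumes "lipschitz_differentiable L f"
  shows "GDERIV (\<lambda>y. real_of_ereal (f y)) x :> grad f x"
proof -
  obtain D where D: "GDERIV (\<lambda>y. real_of_ereal (f y)) x :> D"
    using assms by (auto simp: lipschitz_differentiable_def)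
  have "D' = D" if "GDERIV (\<lambda>y. real_of_ereal (f y)) x :> D'" for D'
  proof -
    have "(\<lambda>h. inner h D') = (\<lambda>h. inner h D)"
      using D that unfolding gderiv_def by (rule has_derivative_unique[rotated])
    then show ?thesis by (metis vector_eq_ldot)
  qed
  with D show ?thesis unfolding grad_def by (rule theI)
qed

text \<open>The three entries of the maximum are cocoercivity, strong monotonicity and their sharper
  combination. The first and the last are one lemma, used with modulus 0 and with modulus
  \<open>\<mu>\<close>.\<close>

lemma Q_subdifferential_le_inner:
  fixes f :: "'a::real_inner \<Rightarrow> ereal"
  assumes "\<mu> \<ge> 0" "\<beta> \<ge> 0" and f: "proper_closed_convex f"
    and convex: "\<mu> > 0 \<longrightarrow> strongly_convex \<mu> f"
    and smooth: "\<beta> > 0 \<longrightarrow> lipschitz_differentiable (1 / \<beta>) f"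
    and u: "u \<in> subdifferential f x" and v: "v \<in> subdifferential f y"
  shows "Q_subdifferential \<mu> \<beta> f x y \<le> inner (x - y) (u - v)"
proof -
  obtain rx ry where rx: "f x = ereal rx" and ry: "f y = ereal ry"
    using subdifferential_finite[OF f u] subdifferential_finite[OF f v] by auto
  have strong: "\<mu> * (norm (x - y))\<^sup>2 \<le> inner (x - y) (u - v)"
    using strongly_convex_subgradient_ge[OF convex \<open>\<mu> \<ge> 0\<close> u rx ry]
      strongly_convex_subgradient_ge[OF convex \<open>\<mu> \<ge> 0\<close> v ry rx]
    by (simp add: norm_minus_commute inner_diff_left inner_diff_right inner_commute)
  show ?thesis
  proof (cases "\<beta> = 0")
    case True
    then show ?thesis
      using strong order_trans[OF _ strong, of 0] \<open>\<mu> \<ge> 0\<close> by (simp add: Q_subdifferential_def)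
  next
    case False
    then have "\<beta> > 0" using \<open>\<beta> \<ge> 0\<close> by simp
    with smooth have L: "lipschitz_differentiable (1 / \<beta>) f" by simp
    define g where "g = (\<lambda>y. real_of_ereal (f y))"
    have g: "f w = ereal (g w)" for w
      using L by (simp add: g_def lipschitz_differentiable_def ereal_real')
    have deriv: "GDERIV g w :> grad f w" for w
      unfolding g_def by (rule GDERIV_grad[OF L])
    have lipschitz: "norm (grad f w - grad f w') \<le> (1 / \<beta>) * norm (w - w')" for w w'
      using L unfolding lipschitz_differentiable_def
      by (metis UNIV_I dist_norm lipschitz_onD)
    have lower: "g a + inner s (w - a) + \<mu> / 2 * (norm (w - a))\<^sup>2 \<le> g w"
      if "s \<in> subdifferential f a" for a s w
      by (rule strongly_convex_subgradient_ge[OF convex \<open>\<mu> \<ge> 0\<close> that g g])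
    \<comment> \<open>The factor \<open>0 / 2\<close> keeps the shape required by the cocoercivity
      lemma at modulus 0.\<close>
    have lower0: "g a + inner s (w - a) + 0 / 2 * (norm (w - a))\<^sup>2 \<le> g w"
      if "s \<in> subdifferential f a" for a s w
      by (rule strongly_convex_subgradient_ge[OF _ _ that g g]) auto
    have grad: "s = grad f a" if "s \<in> subdifferential f a" for a s
      using GDERIV_subgradient_eq[OF deriv] lower0[OF that] by simp
    have upper: "g w \<le> g a + inner (grad f a) (w - a) + (1 / \<beta>) / 2 * (norm (w - a))\<^sup>2" for a w
      by (rule descent_lemma[OF deriv lipschitz])
    have "(norm (u - v))\<^sup>2 + \<mu> * (1 / \<beta>) * (norm (x - y))\<^sup>2 \<le> (1 / \<beta> + \<mu>) * inner (x - y) (u - v)"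
      using lower[OF u] lower[OF v] upper lipschitz \<open>\<mu> \<ge> 0\<close>
      unfolding grad[OF u] grad[OF v]
      by (intro strongly_convex_smooth_cocoercive[where f = g]) auto
    \<comment> \<open>With \<open>L = 1 / \<beta>\<close>, multiplying by \<open>\<beta>\<close>
      turns the constant \<open>L + \<mu>\<close> into the denominator
      \<open>\<mu> * \<beta> + 1\<close>.\<close>
    then have "\<beta> * ((norm (u - v))\<^sup>2 + \<mu> * (1 / \<beta>) * (norm (x - y))\<^sup>2)
        \<le> \<beta> * ((1 / \<beta> + \<mu>) * inner (x - y) (u - v))"
      using \<open>\<beta> > 0\<close> by (intro mult_left_mono) auto
    then have "\<beta> * (norm (u - v))\<^sup>2 + \<mu> * (norm (x - y))\<^sup>2 \<le> (\<mu> * \<beta> + 1) * inner (x - y) (u - v)"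
      using \<open>\<beta> > 0\<close> by (simp add: distrib_left distrib_right mult_ac)
    moreover have "\<mu> * \<beta> + 1 > 0"
      using \<open>\<mu> \<ge> 0\<close> \<open>\<beta> > 0\<close> by (simp add: add_nonneg_pos)
    ultimately have "(\<beta> * (norm (u - v))\<^sup>2 + \<mu> * (norm (x - y))\<^sup>2) / (\<mu> * \<beta> + 1) \<le> inner (x - y) (u - v)"
      by (simp add: divide_le_eq mult.commute)
    then have combined: "\<mu> / (\<mu> * \<beta> + 1) * (norm (x - y))\<^sup>2 + \<beta> / (\<mu> * \<beta> + 1) * (norm (u - v))\<^sup>2
        \<le> inner (x - y) (u - v)"
      by (simp add: add_divide_distrib add.commute)
    have "(norm (u - v))\<^sup>2 + 0 * (1 / \<beta>) * (norm (x - y))\<^sup>2 \<le> (1 / \<beta> + 0) * inner (x - y) (u - v)"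
      using lower0[OF u] lower0[OF v] upper lipschitz
      unfolding grad[OF u] grad[OF v]
      by (intro strongly_convex_smooth_cocoercive[where f = g]) auto
    then have "\<beta> * (norm (u - v))\<^sup>2 \<le> inner (x - y) (u - v)"
      using \<open>\<beta> > 0\<close> by (simp add: field_simps)
    with strong combined show ?thesis
      by (simp add: Q_subdifferential_def flip: grad[OF u] grad[OF v])
  qed
qed

lemma Q_monotone_le_inner:
  assumes "monotone_op S" "\<mu> \<ge> 0" "\<beta> \<ge> 0"
    and strong: "\<mu> > 0 \<longrightarrow> strongly_monotone \<mu> S" and coco: "\<beta> > 0 \<longrightarrow> cocoercive \<beta> S"
    and u: "u \<in> S x" and v: "v \<in> S y"
  shows "Q_monotone \<mu> \<beta> S x y \<le> inner (x - y) (u - v)"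
proof -
  have mono: "0 \<le> inner (x - y) (u - v)"
    using assms by (auto simp: monotone_op_def)
  have "\<mu> * (norm (x - y))\<^sup>2 \<le> inner (x - y) (u - v)"
    using mono strong u v \<open>\<mu> \<ge> 0\<close> by (cases "\<mu> = 0") (auto simp: strongly_monotone_def)
  moreover have "\<beta> * (norm (the_elem (S x) - the_elem (S y)))\<^sup>2 \<le> inner (x - y) (u - v)"
  proof (cases "\<beta> = 0")
    case False
    then have "\<beta> > 0" using \<open>\<beta> \<ge> 0\<close> by simp
    then have *: "\<beta> * (norm (s - t))\<^sup>2 \<le> inner (a - b) (s - t)" if "s \<in> S a" "t \<in> S b" for a b s t
      using coco that by (auto simp: cocoercive_def)
    \<comment> \<open>Cocoercivity at a single point makes the values singletons, so
      \<open>the_elem\<close> returns \<open>u\<close> and \<open>v\<close>.\<close>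
    have "s = t" if "s \<in> S a" "t \<in> S a" for a s t
      using *[OF that] \<open>\<beta> > 0\<close> by (simp add: mult_le_0_iff)
    then have "S x = {u}" "S y = {v}" using u v by auto
    then show ?thesis using *[OF u v] by simp
  qed (use mono in simp)
  ultimately show ?thesis by (simp add: Q_monotone_def)
qed

text \<open>This bound and nonnegativity are all that the convergence proof uses about these
  functions.\<close>

lemma Q_function_le_inner:
  assumes "Q_function S Q" "u \<in> S x" "v \<in> S y"
  shows "Q x y \<le> inner (x - y) (u - v)"
  using assms by (cases rule: Q_function.cases)
    (auto intro: Q_monotone_le_inner Q_subdifferential_le_inner)

lemma Q_function_nonneg: "Q_function S Q \<Longrightarrow> 0 \<le> Q x y"
  by (cases rule: Q_function.cases)
    (auto simp: Q_monotone_def Q_subdifferential_def le_max_iff_disj)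

section \<open>Rates of monotone sequences\<close>

text \<open>A tail block ending at \<open>n\<close> is small, yet at least its length times its last
  term \<open>a n\<close>.\<close>

lemma decseq_summable_index_mult_tendsto_0:
  fixes a :: "nat \<Rightarrow> real"
  assumes "decseq a" "summable a" and nonneg: "\<And>n. 0 \<le> a n"
  shows "(\<lambda>n. (real n + 1) * a n) \<longlonglongrightarrow> 0"
proof (rule LIMSEQ_I)
  fix e :: real assume "e > 0"
  then obtain N where N: "\<And>m n. m \<ge> N \<Longrightarrow> norm (sum a {m..<n}) < e / 2"
    using \<open>summable a\<close> unfolding summable_Cauchy by (meson half_gt_zero)
  have "norm ((real n + 1) * a n - 0) < e" if "n \<ge> 2 * N" for n
  proof -
    have "real (card {N..<Suc n}) * a n \<le> sum a {N..<Suc n}"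
      using decseqD[OF \<open>decseq a\<close>] by (intro sum_bounded_below) auto
    also have "\<dots> < e / 2" using N[of N "Suc n"] by simp
    finally have "2 * (real (card {N..<Suc n}) * a n) < e" by simp
    \<comment> \<open>From \<open>n \<ge> 2 * N\<close> on, the block from \<open>N\<close> to
      \<open>n\<close> contains more than half of the \<open>n + 1\<close> indices.\<close>
    moreover have "(real n + 1) * a n \<le> 2 * real (card {N..<Suc n}) * a n"
      using that nonneg by (intro mult_right_mono) (auto simp: of_nat_diff)
    ultimately show ?thesis using nonneg by simp
  qed
  then show "\<exists>no. \<forall>n\<ge>no. norm ((real n + 1) * a n - 0) < e" by blast
qed

text \<open>The running minimum is decreasing and lies below \<open>q\<close>, so it inherits
  summability.\<close>

lemma Min_prefix_smallo:
  fixes q :: "nat \<Rightarrow> real"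
  assumes nonneg: "\<And>k. 0 \<le> q k" and "summable q"
  shows "(\<lambda>k. Min (q ` {0..k})) \<in> o(\<lambda>k. 1 / (real k + 1))"
proof -
  define m where "m = (\<lambda>k. Min (q ` {0..k}))"
  have m_nonneg: "0 \<le> m k" for k
    using nonneg by (simp add: m_def)
  have "decseq m"
    unfolding m_def by (intro decseq_SucI Min_antimono) auto
  moreover have "summable m"
    using \<open>summable q\<close> by (rule summable_comparison_test')
      (use m_nonneg in \<open>auto simp: m_def\<close>)
  ultimately have "(\<lambda>k. (real k + 1) * m k) \<longlonglongrightarrow> 0"
    using m_nonneg by (rule decseq_summable_index_mult_tendsto_0)
  then have "m \<in> o(\<lambda>k. 1 / (real k + 1))"
    by (intro smalloI_tendsto) (auto simp: mult.commute)
  then show ?thesis by (simp add: m_def)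
qed

text \<open>Telescoping bounds the partial sums of \<open>t * d i\<close> by \<open>V 0\<close>, and
  the last term is the smallest. Here \<open>d\<close> will be the squared residual and
  \<open>V\<close> the squared distance to the fixed point.\<close>

lemma decreasing_residual_rate:
  fixes V d :: "nat \<Rightarrow> real"
  assumes V: "\<And>k. 0 \<le> V k" and step: "\<And>k. t * d k \<le> V k - V (Suc k)"
    and "t > 0" "decseq d" and d: "\<And>k. 0 \<le> d k"
  shows "t * (real k + 1) * d k \<le> V 0" and "(\<lambda>k. (real k + 1) * d k) \<longlonglongrightarrow> 0"
proof -
  have sum_le: "(\<Sum>i\<le>k. t * d i) \<le> V 0" for k
  proof -
    have "(\<Sum>i\<le>k. t * d i) \<le> (\<Sum>i\<le>k. V i - V (Suc i))"
      by (intro sum_mono step)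
    then show ?thesis using V[of "Suc k"] by (simp add: sum_telescope)
  qed
  have "real (card {..k}) * (t * d k) \<le> (\<Sum>i\<le>k. t * d i)"
    using decseqD[OF \<open>decseq d\<close>] \<open>t > 0\<close> by (intro sum_bounded_below) auto
  with sum_le[of k] show "t * (real k + 1) * d k \<le> V 0"
    by (simp add: algebra_simps)
  have "summable (\<lambda>i. t * d i)"
    using sum_le d \<open>t > 0\<close> by (intro bounded_imp_summable[where B = "V 0"]) auto
  then have "summable d"
    using \<open>t > 0\<close> by (simp add: summable_cmult_iff)
  then show "(\<lambda>k. (real k + 1) * d k) \<longlonglongrightarrow> 0"
    by (intro decseq_summable_index_mult_tendsto_0 \<open>decseq d\<close> d)
qed

text \<open>Summation by parts turns weighted differences into the plain sum of the
  \<open>V i\<close> minus a boundary term; each \<open>V i\<close> is at most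
  \<open>V 0\<close>.\<close>

lemma weighted_sum_le_telescope:
  fixes V p :: "nat \<Rightarrow> real"
  assumes step: "\<And>k. p k \<le> V k - V (Suc k)" and V: "\<And>k. 0 \<le> V k" and "decseq V"
  shows "(\<Sum>i=0..k. (real i + 1) * p i) \<le> (real k + 1) * V 0"
proof -
  have "(\<Sum>i=0..k. (real i + 1) * p i) \<le> (\<Sum>i=0..k. V i) - (real k + 1) * V (Suc k)"
  proof (induction k)
    case (Suc k)
    have "(real (Suc k) + 1) * p (Suc k) \<le> (real (Suc k) + 1) * (V (Suc k) - V (Suc (Suc k)))"
      by (intro mult_left_mono step) auto
    with Suc show ?case by (simp add: algebra_simps)
  qed (use step[of 0] in simp)
  also have "\<dots> \<le> (\<Sum>i=0..k. V i)" using V by simp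
  also have "\<dots> \<le> real (card {0..k}) * V 0"
    using decseqD[OF \<open>decseq V\<close>] by (intro sum_bounded_above) auto
  finally show ?thesis by (simp add: algebra_simps)
qed

section \<open>One step of the splitting\<close>

text \<open>Expanding \<open>r' = r + (r' - r)\<close> expresses the change of the squared norm
  through \<open>inner (r' - r) d\<close>, since \<open>d\<close> is a multiple of
  \<open>r\<close>.\<close>

lemma averaged_residual_norm_le:
  fixes r r' d :: "'a::real_inner"
  assumes averaged: "\<rho> * (norm (r' - r))\<^sup>2 \<le> inner (r' - r) d" and d: "d = - (l *\<^sub>R r)"
    and "0 < l" "l \<le> 2 * \<rho>"
  shows "(norm r')\<^sup>2 \<le> (norm r)\<^sup>2"
proof -
  have "l * ((norm r')\<^sup>2 - (norm r)\<^sup>2) = (l - 2 * \<rho>) * (norm (r' - r))\<^sup>2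
      + 2 * (\<rho> * (norm (r' - r))\<^sup>2 - inner (r' - r) d)"
    by (simp add: d norm_diff_squared inner_diff_left inner_commute power2_norm_eq_inner algebra_simps)
  also have "\<dots> \<le> 0"
    using averaged \<open>l \<le> 2 * \<rho>\<close> mult_nonpos_nonneg[of "l - 2 * \<rho>" "(norm (r' - r))\<^sup>2"] by simp
  finally show ?thesis using \<open>0 < l\<close> by (simp add: mult_le_0_iff)
qed

text \<open>All letters stand for differences between two runs of the scheme. Solving the resolvent
  equations for \<open>uA\<close> and \<open>uB\<close> eliminates both.\<close>

lemma three_operator_gap:
  fixes a b c w uA uB :: "'a::real_inner"
  assumes wB: "w = b + \<gamma> *\<^sub>R uB" and wA: "2 *\<^sub>R b - w - \<gamma> *\<^sub>R c = a + \<gamma> *\<^sub>R uA"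
  shows "\<gamma> * (inner a uA + inner b uB + inner b c)
    = inner (b - a) w - (norm (b - a))\<^sup>2 + \<gamma> * inner (b - a) c"
proof -
  have uB: "\<gamma> *\<^sub>R uB = w - b" and uA: "\<gamma> *\<^sub>R uA = 2 *\<^sub>R b - w - \<gamma> *\<^sub>R c - a"
    using wB wA by simp_all
  have "\<gamma> * (inner a uA + inner b uB + inner b c)
      = inner a (\<gamma> *\<^sub>R uA) + inner b (\<gamma> *\<^sub>R uB) + \<gamma> * inner b c"
    by (simp add: algebra_simps)
  also have "\<dots> = inner (b - a) w - (norm (b - a))\<^sup>2 + \<gamma> * inner (b - a) c"
    unfolding uA uB
    by (simp add: power2_norm_eq_inner inner_diff_left inner_diff_right inner_commute algebra_simps)
  finally show ?thesis .
qed

lemma three_operator_residual_ge: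
  fixes a b c w uA uB :: "'a::real_inner"
  assumes wB: "w = b + \<gamma> *\<^sub>R uB" and wA: "2 *\<^sub>R b - w - \<gamma> *\<^sub>R c = a + \<gamma> *\<^sub>R uA"
    and mono: "0 \<le> inner a uA" "0 \<le> inner b uB" and coco: "\<beta> * (norm c)\<^sup>2 \<le> inner b c"
    and "0 < \<gamma>"
  shows "(norm (b - a))\<^sup>2 - \<gamma> * inner (b - a) c + \<gamma> * \<beta> * (norm c)\<^sup>2 \<le> inner (b - a) w"
proof -
  have "\<gamma> * (\<beta> * (norm c)\<^sup>2) \<le> \<gamma> * (inner a uA + inner b uB + inner b c)"
    using mono coco \<open>0 < \<gamma>\<close> by (intro mult_left_mono) auto
  then show ?thesis unfolding three_operator_gap[OF wB wA] by simp
qed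

text \<open>The conclusion is averagedness of \<open>T\<close> with constant
  \<open>1 / (2 - \<epsilon>)\<close>, phrased as cocoercivity of its residual.\<close>

lemma cocoercive_residual_averaged:
  fixes r c w :: "'a::real_inner"
  assumes refined: "(norm r)\<^sup>2 - \<gamma> * inner r c + \<gamma> * \<beta> * (norm c)\<^sup>2 \<le> inner r w"
    and "0 < \<gamma>" "0 < \<beta>" "\<gamma> \<le> 2 * \<beta> * \<epsilon>"
  shows "(1 - \<epsilon> / 2) * (norm r)\<^sup>2 \<le> inner r w"
proof -
  \<comment> \<open>This square is chosen so that its \<open>c\<close> terms are exactly those of
    \<open>refined\<close>.\<close>
  have "0 \<le> \<gamma> / (4 * \<beta>) * (norm (r - (2 * \<beta>) *\<^sub>R c))\<^sup>2"
    using assms by simp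
  also have "\<dots> = \<gamma> / (4 * \<beta>) * (norm r)\<^sup>2 - \<gamma> * inner r c + \<gamma> * \<beta> * (norm c)\<^sup>2"
    using \<open>0 < \<beta>\<close> by (simp add: norm_diff_squared power_mult_distrib power2_eq_square[of \<beta>] field_simps)
  finally have "\<gamma> * inner r c - \<gamma> * \<beta> * (norm c)\<^sup>2 \<le> \<gamma> / (4 * \<beta>) * (norm r)\<^sup>2" by simp
  also have "\<dots> \<le> \<epsilon> / 2 * (norm r)\<^sup>2"
    using assms by (intro mult_right_mono) (auto simp: field_simps)
  finally show ?thesis using refined by (simp add: algebra_simps)
qed

text \<open>With \<open>D\<close> the decrease of the squared distance and \<open>N\<close> the
  excess to absorb, the gap gives \<open>D + l * N\<close>, and \<open>l * N\<close> is itself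
  bounded by a multiple of \<open>D\<close>.\<close>

lemma relaxation_step_gap_le:
  fixes r c w :: "'a::real_inner"
  assumes refined: "(norm r)\<^sup>2 - \<gamma> * inner r c + \<gamma> * \<beta> * (norm c)\<^sup>2 \<le> inner r w"
    and gap: "\<gamma> * q \<le> inner r w - (norm r)\<^sup>2 + \<gamma> * inner r c"
    and "0 < \<gamma>" "0 < \<epsilon>" "\<gamma> < 2 * \<beta> * \<epsilon>" "0 < l" "l \<le> 2 - \<epsilon>"
  shows "2 * \<gamma> * l * q
    \<le> (1 + \<gamma> / (2 * \<beta> * \<epsilon> - \<gamma>)) * ((norm w)\<^sup>2 - (norm (w - l *\<^sub>R r))\<^sup>2)"
proof -
  define D where "D = (norm w)\<^sup>2 - (norm (w - l *\<^sub>R r))\<^sup>2"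
  define N where "N = 2 * (\<gamma> * inner r c) - \<epsilon> * (norm r)\<^sup>2"
  have "0 < 2 * \<beta> * \<epsilon> - \<gamma>" using assms by simp
  have D: "D = 2 * l * inner r w - l * l * (norm r)\<^sup>2"
    by (simp add: D_def norm_diff_squared power_mult_distrib power2_eq_square[of l] inner_commute)
  have N: "\<epsilon> * N \<le> \<gamma>\<^sup>2 * (norm c)\<^sup>2"
  proof -
    have "0 \<le> (norm (\<epsilon> *\<^sub>R r - \<gamma> *\<^sub>R c))\<^sup>2" by simp
    then show ?thesis
      by (simp add: norm_diff_squared power_mult_distrib N_def power2_eq_square[of \<epsilon>] algebra_simps
          del: zero_le_power2)
  qed
  \<comment> \<open>The bound \<open>l \<le> 2 - \<epsilon>\<close> lets the leftover multiple of
    the squared residual be discarded twice below.\<close>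
  have relax: "l * ((l + \<epsilon> - 2) * (norm r)\<^sup>2) \<le> 0"
    using assms by (intro mult_nonneg_nonpos mult_nonpos_nonneg) auto
  have "l * ((norm r)\<^sup>2 - \<gamma> * inner r c + \<gamma> * \<beta> * (norm c)\<^sup>2) \<le> l * inner r w"
    using refined \<open>0 < l\<close> by simp
  then have "l * (2 * \<gamma> * \<beta> * (norm c)\<^sup>2 - N) \<le> D"
    using relax by (simp add: D N_def algebra_simps)
  then have "\<epsilon> * (l * (2 * \<gamma> * \<beta> * (norm c)\<^sup>2 - N)) \<le> \<epsilon> * D"
    using \<open>0 < \<epsilon>\<close> by simp
  moreover have "l * (\<epsilon> * N) \<le> l * (\<gamma>\<^sup>2 * (norm c)\<^sup>2)"
    using N \<open>0 < l\<close> by simp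
  \<comment> \<open>Inserting Young's bound \<open>N\<close> for the excess shows that the decrease
    controls \<open>c\<close>; the coefficient is positive because
    \<open>\<gamma> < 2 * \<beta> * \<epsilon>\<close>.\<close>
  ultimately have descent: "\<gamma> * ((2 * \<beta> * \<epsilon> - \<gamma>) * (l * (norm c)\<^sup>2)) \<le> \<epsilon> * D"
    by (simp add: algebra_simps power2_eq_square[of \<gamma>])
  have "(2 * \<beta> * \<epsilon> - \<gamma>) * (\<epsilon> * (l * N)) \<le> \<gamma> * (\<epsilon> * D)"
  proof -
    have "(2 * \<beta> * \<epsilon> - \<gamma>) * (l * (\<epsilon> * N)) \<le> (2 * \<beta> * \<epsilon> - \<gamma>) * (l * (\<gamma>\<^sup>2 * (norm c)\<^sup>2))"
      using N \<open>0 < l\<close> \<open>0 < 2 * \<beta> * \<epsilon> - \<gamma>\<close> by (intro mult_left_mono) auto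
    also have "\<dots> = \<gamma> * (\<gamma> * ((2 * \<beta> * \<epsilon> - \<gamma>) * (l * (norm c)\<^sup>2)))"
      by (simp add: power2_eq_square[of \<gamma>])
    also have "\<dots> \<le> \<gamma> * (\<epsilon> * D)"
      using descent \<open>0 < \<gamma>\<close> by (rule mult_left_mono[OF _ less_imp_le])
    finally show ?thesis by (simp add: mult_ac)
  qed
  then have "\<epsilon> * ((2 * \<beta> * \<epsilon> - \<gamma>) * (l * N)) \<le> \<epsilon> * (\<gamma> * D)"
    by (simp add: mult_ac)
  then have "l * N \<le> \<gamma> / (2 * \<beta> * \<epsilon> - \<gamma>) * D"
    using \<open>0 < \<epsilon>\<close> \<open>0 < 2 * \<beta> * \<epsilon> - \<gamma>\<close> by (simp add: pos_le_divide_eq mult_ac)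
  moreover have "2 * \<gamma> * l * q \<le> D + l * N"
  proof -
    have "l * (\<gamma> * q) \<le> l * (inner r w - (norm r)\<^sup>2 + \<gamma> * inner r c)"
      using gap \<open>0 < l\<close> by simp
    then show ?thesis
      using relax by (simp add: D N_def algebra_simps)
  qed
  ultimately have "2 * \<gamma> * l * q \<le> D + \<gamma> / (2 * \<beta> * \<epsilon> - \<gamma>) * D" by linarith
  then show ?thesis by (simp add: D_def distrib_right)
qed

text \<open>Firm nonexpansiveness of the resolvent and cocoercivity bound \<open>c\<close> by
  \<open>norm w / \<beta>\<close>. The negative square is absorbed by passing to
  \<open>w - r\<close>, which is no longer than \<open>w\<close>.\<close>

lemma gap_le_residual_mult_distance:
  fixes r b c w :: "'a::real_inner"
  assumes gap: "\<gamma> * q \<le> inner r w - (norm r)\<^sup>2 + \<gamma> * inner r c"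
    and averaged: "(1 - \<epsilon> / 2) * (norm r)\<^sup>2 \<le> inner r w"
    and coco: "\<beta> * (norm c)\<^sup>2 \<le> inner b c" and wB: "w = b + \<gamma> *\<^sub>R uB" and "0 \<le> inner b uB"
    and "0 < \<gamma>" "0 < \<beta>" "\<epsilon> \<le> 1"
  shows "\<gamma> * q \<le> (1 + \<gamma> / \<beta>) * norm r * norm w"
proof -
  have norm_leI: "norm x \<le> norm y" if "(norm x)\<^sup>2 \<le> inner x y" for x y :: 'a
    using that norm_cauchy_schwarz[of x y]
    by (cases "x = 0") (auto simp: power2_eq_square dest: order_trans)
  have "norm b \<le> norm w"
    using \<open>0 < \<gamma>\<close> \<open>0 \<le> inner b uB\<close>
    by (intro norm_leI) (simp add: wB inner_add_right power2_norm_eq_inner)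
  moreover have "norm (\<beta> *\<^sub>R c) \<le> norm b"
  proof (rule norm_leI)
    have "\<beta> * (\<beta> * (norm c)\<^sup>2) \<le> \<beta> * inner b c" using coco \<open>0 < \<beta>\<close> by simp
    then show "(norm (\<beta> *\<^sub>R c))\<^sup>2 \<le> inner (\<beta> *\<^sub>R c) b"
      by (simp add: power_mult_distrib power2_eq_square[of \<beta>] inner_commute mult_ac)
  qed
  ultimately have c: "norm c \<le> norm w / \<beta>"
    using \<open>0 < \<beta>\<close> by (simp add: field_simps)
  have "(norm r)\<^sup>2 \<le> 2 * inner r w"
  proof -
    have "1 / 2 * (norm r)\<^sup>2 \<le> (1 - \<epsilon> / 2) * (norm r)\<^sup>2"
      using \<open>\<epsilon> \<le> 1\<close> by (intro mult_right_mono) auto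
    with averaged show ?thesis by simp
  qed
  then have "(norm (w - r))\<^sup>2 \<le> (norm w)\<^sup>2"
    by (simp add: norm_diff_squared inner_commute)
  then have wr: "norm (w - r) \<le> norm w" by (simp add: power2_le_iff_abs_le)
  have "\<gamma> * q \<le> inner r (w - r) + \<gamma> * inner r c"
    using gap by (simp add: inner_diff_right power2_norm_eq_inner)
  also have "\<dots> \<le> norm r * norm w + \<gamma> * (norm r * (norm w / \<beta>))"
  proof (intro add_mono mult_left_mono)
    show "inner r (w - r) \<le> norm r * norm w"
      using norm_cauchy_schwarz[of r "w - r"] wr by (meson mult_left_mono norm_ge_zero order_trans)
    show "inner r c \<le> norm r * (norm w / \<beta>)"
      using norm_cauchy_schwarz[of r c] c by (meson mult_left_mono norm_ge_zero order_trans)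
  qed (use \<open>0 < \<gamma>\<close> in simp)
  also have "\<dots> = (1 + \<gamma> / \<beta>) * norm r * norm w" by (simp add: algebra_simps)
  finally show ?thesis .
qed

section \<open>Convergence rates\<close>

theorem corollaryD9:
  fixes A B :: "'a::{real_inner, complete_space} \<Rightarrow> 'a set"
    and C T :: "'a \<Rightarrow> 'a"
    and QA QB QC :: "'a \<Rightarrow> 'a \<Rightarrow> real"
    and \<beta> \<epsilon> \<gamma> \<alpha> :: real
    and lam q :: "nat \<Rightarrow> real"
    and z xA xB :: "nat \<Rightarrow> 'a"
    and zstar xstar :: 'a
  assumes "maximal_monotone A" and "maximal_monotone B"
    and "\<beta> > 0" and "cocoercive \<beta> (\<lambda>x. {C x})"
    and "Q_function A QA" and "Q_function B QB" and "Q_function (\<lambda>x. {C x}) QC"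
    and "0 < \<epsilon>" and "\<epsilon> < 1"
    and "0 < \<gamma>" and "\<gamma> < 2 * \<beta> * \<epsilon>"
    and "\<alpha> = 1 / (2 - \<epsilon>)"
    and "\<And>x. T x = x - resolvent (scale_op \<gamma> B) x
           + resolvent (scale_op \<gamma> A)
               (2 *\<^sub>R resolvent (scale_op \<gamma> B) x - x - \<gamma> *\<^sub>R C (resolvent (scale_op \<gamma> B) x))"
    and "T zstar = zstar"
    and "xstar = resolvent (scale_op \<gamma> B) zstar"
    and "\<And>k. z (Suc k) = (1 - lam k) *\<^sub>R z k + lam k *\<^sub>R T (z k)"
    and "\<And>k. xB k = resolvent (scale_op \<gamma> B) (z k)"
    and "\<And>k. xA k = resolvent (scale_op \<gamma> A) (2 *\<^sub>R xB k - z k - \<gamma> *\<^sub>R C (xB k))"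
    and "\<And>k. q k = QA (xA k) xstar + QB (xB k) xstar + QC (xB k) xstar"
  shows
    "((\<forall>j. 0 < lam j \<and> lam j < 1 / \<alpha>) \<and> (INF j. lam j * (1 - \<alpha> * lam j) / \<alpha>) > 0 \<longrightarrow>
       (\<forall>k. q k \<le> (1 + \<gamma> / \<beta>) * (norm (z 0 - zstar))\<^sup>2
                / (\<gamma> * sqrt ((INF j. lam j * (1 - \<alpha> * lam j) / \<alpha>) * (real k + 1)))) \<and>
       q \<in> o(\<lambda>k. 1 / sqrt (real k + 1)))
     \<and>
     ((\<forall>j. 0 < lam j \<and> lam j < 1 / \<alpha>) \<and> (INF j. lam j * (1 - \<alpha> * lam j) / \<alpha>) > 0 \<longrightarrow>
       (\<forall>k. Min (q ` {0..k}) \<le> (1 + \<gamma> / (2 * \<beta> * \<epsilon> - \<gamma>)) * (norm (z 0 - zstar))\<^sup>2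
                / (2 * \<gamma> * (INF j. lam j) * (real k + 1))) \<and>
       (\<lambda>k. Min (q ` {0..k})) \<in> o(\<lambda>k. 1 / (real k + 1)))
     \<and>
     ((\<forall>j. 0 < lam j \<and> lam j \<le> 1 / \<alpha>) \<longrightarrow>
       (\<forall>k. 1 / (\<Sum>i=0..k. lam i) * (\<Sum>i=0..k. lam i * q i)
            \<le> (1 + \<gamma> / (2 * \<beta> * \<epsilon> - \<gamma>)) * (norm (z 0 - zstar))\<^sup>2
                / (2 * \<gamma> * (\<Sum>i=0..k. lam i))))
     \<and>
     (\<forall>l. 0 < l \<and> l \<le> 1 / \<alpha> \<and> (\<forall>j. lam j = l) \<longrightarrow>
       (\<forall>k. 2 / ((real k + 1) * (real k + 2)) * (\<Sum>i=0..k. (real i + 1) * q i)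
            \<le> (1 + \<gamma> / (2 * \<beta> * \<epsilon> - \<gamma>)) * (norm (z 0 - zstar))\<^sup>2
                / (\<gamma> * l * (real k + 1))))"
proof -

  \<comment> \<open>Monotonicity inequalities for arbitrary pairs of points\<close>
  define P where "P = (\<lambda>y. resolvent (scale_op \<gamma> B) y)"
  define N where "N = (\<lambda>y. 2 *\<^sub>R P y - y - \<gamma> *\<^sub>R C (P y))"
  define F where "F = (\<lambda>y. resolvent (scale_op \<gamma> A) (N y))"
  define R where "R = (\<lambda>y. P y - F y)"
  note pos = assms(3) assms(8-11)
  have T: "T y = y - R y" for y
    by (simp add: assms(13) P_def F_def N_def R_def)
  obtain uB where uB: "\<And>y. uB y \<in> B (P y)" "\<And>y. y = P y + \<gamma> *\<^sub>R uB y"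
    using resolvent_solves[OF assms(2) \<open>0 < \<gamma>\<close>] unfolding P_def by metis
  have "\<exists>u\<in>A (F y). N y = F y + \<gamma> *\<^sub>R u" for y
    unfolding F_def by (rule resolvent_solves[OF assms(1) \<open>0 < \<gamma>\<close>])
  then obtain uA where uA: "\<And>y. uA y \<in> A (F y)" "\<And>y. N y = F y + \<gamma> *\<^sub>R uA y"
    by metis
  have wB: "x - y = (P x - P y) + \<gamma> *\<^sub>R (uB x - uB y)" for x y
    using uB(2)[of x] uB(2)[of y] by (simp add: algebra_simps)
  have wA: "2 *\<^sub>R (P x - P y) - (x - y) - \<gamma> *\<^sub>R (C (P x) - C (P y))
      = (F x - F y) + \<gamma> *\<^sub>R (uA x - uA y)" for x y
    using uA(2)[of x] uA(2)[of y] by (simp add: N_def algebra_simps)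
  have monoA: "0 \<le> inner (F x - F y) (uA x - uA y)" for x y
    using assms(1) uA(1) by (auto simp: maximal_monotone_def monotone_op_def)
  have monoB: "0 \<le> inner (P x - P y) (uB x - uB y)" for x y
    using assms(2) uB(1) by (auto simp: maximal_monotone_def monotone_op_def)
  have coco: "\<beta> * (norm (C x - C y))\<^sup>2 \<le> inner (x - y) (C x - C y)" for x y
    using assms(4) by (auto simp: cocoercive_def)
  have R_diff: "(P x - P y) - (F x - F y) = R x - R y" for x y
    by (simp add: R_def)
  have refined: "(norm (R x - R y))\<^sup>2 - \<gamma> * inner (R x - R y) (C (P x) - C (P y))
      + \<gamma> * \<beta> * (norm (C (P x) - C (P y)))\<^sup>2 \<le> inner (R x - R y) (x - y)" for x y
    using three_operator_residual_ge[OF wB wA monoA monoB coco \<open>0 < \<gamma>\<close>] by (simp only: R_diff)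
  have averaged: "(1 - \<epsilon> / 2) * (norm (R x - R y))\<^sup>2 \<le> inner (R x - R y) (x - y)" for x y
    using cocoercive_residual_averaged[OF refined] pos by simp

  \<comment> \<open>Comparison of the iterates with the fixed point\<close>
  have R_star: "R zstar = 0" using T[of zstar] assms(14) by simp
  then have x_star: "P zstar = xstar" "F zstar = xstar"
    using assms(15) by (auto simp: R_def P_def)
  define w r c where "w = (\<lambda>k. z k - zstar)" and "r = (\<lambda>k. R (z k))"
    and "c = (\<lambda>k. C (P (z k)) - C xstar)"
  define V where "V = (\<lambda>k. (norm (w k))\<^sup>2)"
  have xB: "xB k = P (z k)" for k by (simp add: assms(17) P_def)
  have xA: "xA k = F (z k)" for k by (simp add: assms(18) F_def N_def xB)
  have w_Suc: "w (Suc k) = w k - lam k *\<^sub>R r k" for k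
    by (simp add: w_def r_def assms(16) T algebra_simps)
  have refined_k: "(norm (r k))\<^sup>2 - \<gamma> * inner (r k) (c k) + \<gamma> * \<beta> * (norm (c k))\<^sup>2
      \<le> inner (r k) (w k)" for k
    using refined[of "z k" zstar] by (simp add: R_star x_star w_def r_def c_def)
  have averaged_k: "(1 - \<epsilon> / 2) * (norm (r k))\<^sup>2 \<le> inner (r k) (w k)" for k
    using averaged[of "z k" zstar] by (simp add: R_star w_def r_def)
  have gap: "\<gamma> * q k \<le> inner (r k) (w k) - (norm (r k))\<^sup>2 + \<gamma> * inner (r k) (c k)" for k
  proof -
    have "QA (F (z k)) (F zstar) \<le> inner (F (z k) - F zstar) (uA (z k) - uA zstar)"
      by (rule Q_function_le_inner[OF assms(5) uA(1) uA(1)])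
    moreover have "QB (P (z k)) (P zstar) \<le> inner (P (z k) - P zstar) (uB (z k) - uB zstar)"
      by (rule Q_function_le_inner[OF assms(6) uB(1) uB(1)])
    moreover have "QC (P (z k)) (P zstar) \<le> inner (P (z k) - P zstar) (C (P (z k)) - C (P zstar))"
      by (rule Q_function_le_inner[OF assms(7)]) auto
    ultimately have "\<gamma> * q k \<le> \<gamma> * (inner (F (z k) - F zstar) (uA (z k) - uA zstar)
        + inner (P (z k) - P zstar) (uB (z k) - uB zstar)
        + inner (P (z k) - P zstar) (C (P (z k)) - C (P zstar)))"
      using \<open>0 < \<gamma>\<close> unfolding assms(19) xA xB x_star by (intro mult_left_mono) auto
    then show ?thesis
      unfolding three_operator_gap[OF wB wA] R_diff by (simp add: R_star x_star w_def r_def c_def)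
  qed
  have q_nonneg: "0 \<le> q k" for k
    unfolding assms(19) by (intro add_nonneg_nonneg Q_function_nonneg[OF assms(5)]
        Q_function_nonneg[OF assms(6)] Q_function_nonneg[OF assms(7)])
  have q_le: "q k \<le> (1 + \<gamma> / \<beta>) * norm (r k) * norm (w k) / \<gamma>" for k
  proof -
    have "\<beta> * (norm (c k))\<^sup>2 \<le> inner (P (z k) - P zstar) (c k)"
      using coco by (simp add: c_def x_star)
    moreover have "w k = (P (z k) - P zstar) + \<gamma> *\<^sub>R (uB (z k) - uB zstar)"
      unfolding w_def by (rule wB)
    ultimately have "\<gamma> * q k \<le> (1 + \<gamma> / \<beta>) * norm (r k) * norm (w k)"
      using monoB pos by (intro gap_le_residual_mult_distance[OF gap averaged_k]) auto
    then show ?thesis using \<open>0 < \<gamma>\<close> by (simp add: pos_le_divide_eq mult.commute)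
  qed

  \<comment> \<open>Decrease of the squared distance and telescoping\<close>
  define K where "K = 1 + \<gamma> / (2 * \<beta> * \<epsilon> - \<gamma>)"
  have "0 \<le> K" using pos by (simp add: K_def)
  have V_nonneg: "0 \<le> V k" for k by (simp add: V_def)
  have alpha: "1 / \<alpha> = 2 - \<epsilon>" using assms(12) by simp
  have tau: "l * (1 - \<alpha> * l) / \<alpha> = l * (2 - \<epsilon> - l)" for l
    using pos by (simp add: assms(12) field_simps)
  have V_step: "lam k * (1 - \<alpha> * lam k) / \<alpha> * (norm (r k))\<^sup>2 \<le> V k - V (Suc k)"
    if "0 < lam k" for k
  proof -
    have "(2 * lam k) * ((1 - \<epsilon> / 2) * (norm (r k))\<^sup>2) \<le> (2 * lam k) * inner (r k) (w k)"
      using averaged_k that by (intro mult_left_mono) auto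
    then show ?thesis
      unfolding tau
      by (simp add: V_def w_Suc norm_diff_squared power_mult_distrib inner_commute
          power2_eq_square[of "lam k"] algebra_simps)
  qed
  have q_step: "2 * \<gamma> * lam k * q k \<le> K * (V k - V (Suc k))" if "0 < lam k" "lam k \<le> 1 / \<alpha>" for k
    using relaxation_step_gap_le[OF refined_k gap] pos that unfolding alpha K_def V_def w_Suc by simp
  have sum_le: "2 * \<gamma> * (\<Sum>i=0..k. lam i * q i) \<le> K * V 0"
    if "\<forall>j. 0 < lam j \<and> lam j \<le> 1 / \<alpha>" for k
  proof -
    have "(\<Sum>i=0..k. 2 * \<gamma> * lam i * q i) \<le> (\<Sum>i=0..k. K * (V i - V (Suc i)))"
      using that by (intro sum_mono q_step) auto
    also have "\<dots> = K * (V 0 - V (Suc k))"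
      by (simp add: atLeast0AtMost sum_telescope flip: sum_distrib_left)
    also have "\<dots> \<le> K * V 0"
      using V_nonneg \<open>0 \<le> K\<close> by (intro mult_left_mono) auto
    finally show ?thesis by (simp add: sum_distrib_left mult.assoc)
  qed

  have V0: "(norm (z 0 - zstar))\<^sup>2 = V 0" by (simp add: V_def w_def)
  define \<tau> where "\<tau> = (INF j. lam j * (1 - \<alpha> * lam j) / \<alpha>)"
  \<comment> \<open>The admissible range of \<open>lam\<close> makes all terms nonnegative, so the
    real infimum is a genuine lower bound.\<close>
  have tau_le: "\<tau> \<le> lam k * (1 - \<alpha> * lam k) / \<alpha>" if "\<forall>j. 0 < lam j \<and> lam j < 1 / \<alpha>" for k
    unfolding \<tau>_def using that
    by (intro cINF_lower bdd_belowI[of _ 0]) (auto simp: tau alpha less_imp_le)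

  \<comment> \<open>Nonergodic rate\<close>
  have nonergodic: "(\<forall>k. q k \<le> (1 + \<gamma> / \<beta>) * V 0 / (\<gamma> * sqrt (\<tau> * (real k + 1))))
      \<and> q \<in> o(\<lambda>k. 1 / sqrt (real k + 1))"
    if lam: "\<forall>j. 0 < lam j \<and> lam j < 1 / \<alpha>" and "\<tau> > 0"
  proof -
    have step: "\<tau> * (norm (r k))\<^sup>2 \<le> V k - V (Suc k)" for k
      using V_step[of k] lam mult_right_mono[OF tau_le[OF lam, of k], of "(norm (r k))\<^sup>2"] by force
    have "decseq V"
      using step \<open>\<tau> > 0\<close> by (intro decseq_SucI) (smt (verit) mult_nonneg_nonneg zero_le_power2)
    then have w_le: "norm (w k) \<le> norm (w 0)" for k
      using decseqD[OF \<open>decseq V\<close>, of 0 k] by (simp add: V_def power2_le_iff_abs_le)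
    have "decseq (\<lambda>k. (norm (r k))\<^sup>2)"
    proof (rule decseq_SucI)
      fix k
      \<comment> \<open>Averagedness is applied to consecutive iterates here, not to an iterate and
        the fixed point.\<close>
      have "(1 - \<epsilon> / 2) * (norm (r (Suc k) - r k))\<^sup>2 \<le> inner (r (Suc k) - r k) (w (Suc k) - w k)"
        using averaged[of "z (Suc k)" "z k"] by (simp add: r_def w_def)
      then show "(norm (r (Suc k)))\<^sup>2 \<le> (norm (r k))\<^sup>2"
        by (rule averaged_residual_norm_le[where l = "lam k"])
           (use lam[rule_format, of k] alpha w_Suc in auto)
    qed
    note rate = decreasing_residual_rate[OF V_nonneg step \<open>\<tau> > 0\<close> this zero_le_power2]
    define M where "M = (1 + \<gamma> / \<beta>) * norm (w 0) / \<gamma>"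
    have "0 \<le> M" using pos by (simp add: M_def)
    have q_le_M: "q k \<le> M * norm (r k)" for k
    proof -
      have "(1 + \<gamma> / \<beta>) / \<gamma> * norm (r k) * norm (w k) \<le> (1 + \<gamma> / \<beta>) / \<gamma> * norm (r k) * norm (w 0)"
        using w_le pos by (intro mult_left_mono) auto
      then show ?thesis using q_le[of k] by (simp add: M_def mult_ac)
    qed
    have "q k \<le> (1 + \<gamma> / \<beta>) * V 0 / (\<gamma> * sqrt (\<tau> * (real k + 1)))" for k
    proof -
      have s: "0 < sqrt (\<tau> * (real k + 1))" using \<open>\<tau> > 0\<close> by simp
      have "sqrt (\<tau> * (real k + 1) * (norm (r k))\<^sup>2) \<le> sqrt (V 0)"
        using rate(1)[of k] by simp
      then have "norm (r k) \<le> norm (w 0) / sqrt (\<tau> * (real k + 1))"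
        using s by (simp add: V_def real_sqrt_mult pos_le_divide_eq mult_ac)
      then have "M * norm (r k) \<le> M * (norm (w 0) / sqrt (\<tau> * (real k + 1)))"
        using \<open>0 \<le> M\<close> by (rule mult_left_mono)
      with q_le_M[of k] show ?thesis by (simp add: M_def V_def power2_eq_square mult_ac)
    qed
    moreover have "q \<in> o(\<lambda>k. 1 / sqrt (real k + 1))"
    proof (rule smalloI_tendsto)
      have "(\<lambda>k. M * sqrt ((real k + 1) * (norm (r k))\<^sup>2)) \<longlonglongrightarrow> M * sqrt 0"
        by (intro tendsto_intros rate(2))
      then have lim: "(\<lambda>k. M * sqrt ((real k + 1) * (norm (r k))\<^sup>2)) \<longlonglongrightarrow> 0" by simp
      have bound: "q k / (1 / sqrt (real k + 1)) \<le> M * sqrt ((real k + 1) * (norm (r k))\<^sup>2)" for k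
        using mult_right_mono[OF q_le_M[of k], of "sqrt (real k + 1)"]
        by (simp add: real_sqrt_mult mult_ac)
      show "(\<lambda>k. q k / (1 / sqrt (real k + 1))) \<longlonglongrightarrow> 0"
        by (rule tendsto_sandwich[OF _ _ tendsto_const lim])
           (use bound q_nonneg in \<open>auto intro!: always_eventually mult_nonneg_nonneg\<close>)
    qed (simp add: add_nonneg_eq_0_iff)
    ultimately show ?thesis by blast
  qed

  \<comment> \<open>Best-iterate rate\<close>
  have best: "(\<forall>k. Min (q ` {0..k}) \<le> K * V 0 / (2 * \<gamma> * (INF j. lam j) * (real k + 1)))
      \<and> (\<lambda>k. Min (q ` {0..k})) \<in> o(\<lambda>k. 1 / (real k + 1))"
    if lam: "\<forall>j. 0 < lam j \<and> lam j < 1 / \<alpha>" and "\<tau> > 0"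
  proof -
    define \<Lambda> where "\<Lambda> = (INF j. lam j)"
    \<comment> \<open>A positive \<open>\<tau>\<close> keeps the relaxation parameters away from 0,
      which makes \<open>q\<close> itself summable.\<close>
    have lam_ge: "\<tau> * \<alpha> \<le> lam j" for j
    proof -
      have "lam j * (2 - \<epsilon> - lam j) \<le> lam j * (2 - \<epsilon>)"
        using lam by (intro mult_left_mono) (auto intro: less_imp_le)
      with tau_le[OF lam, of j] have "\<tau> \<le> lam j * (2 - \<epsilon>)" unfolding tau by linarith
      then show ?thesis using pos by (simp add: assms(12) field_simps)
    qed
    have "0 < \<tau> * \<alpha>" using \<open>\<tau> > 0\<close> pos by (simp add: assms(12))
    also have "\<dots> \<le> \<Lambda>" unfolding \<Lambda>_def by (intro cINF_greatest lam_ge) auto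
    finally have "0 < \<Lambda>" .
    have \<Lambda>_le: "\<Lambda> \<le> lam j" for j
      unfolding \<Lambda>_def using lam_ge by (intro cINF_lower bdd_belowI[of _ "\<tau> * \<alpha>"]) auto
    have sum_q: "\<Lambda> * (\<Sum>i=0..k. q i) \<le> K * V 0 / (2 * \<gamma>)" for k
    proof -
      have "\<Lambda> * (\<Sum>i=0..k. q i) \<le> (\<Sum>i=0..k. lam i * q i)"
        unfolding sum_distrib_left by (intro sum_mono mult_right_mono \<Lambda>_le q_nonneg)
      also have "\<dots> \<le> K * V 0 / (2 * \<gamma>)"
        using sum_le[of k] lam \<open>0 < \<gamma>\<close> by (simp add: less_imp_le pos_le_divide_eq mult_ac)
      finally show ?thesis .
    qed
    have "Min (q ` {0..k}) \<le> K * V 0 / (2 * \<gamma> * \<Lambda> * (real k + 1))" for k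
    proof -
      have "real (card {0..k}) * Min (q ` {0..k}) \<le> (\<Sum>i=0..k. q i)"
        by (intro sum_bounded_below) auto
      then have "\<Lambda> * ((real k + 1) * Min (q ` {0..k})) \<le> \<Lambda> * (\<Sum>i=0..k. q i)"
        using \<open>0 < \<Lambda>\<close> by (simp add: add.commute)
      with sum_q[of k] have "\<Lambda> * ((real k + 1) * Min (q ` {0..k})) \<le> K * V 0 / (2 * \<gamma>)"
        by linarith
      moreover have "0 < 2 * \<gamma> * \<Lambda> * (real k + 1)"
        using \<open>0 < \<gamma>\<close> \<open>0 < \<Lambda>\<close> by simp
      ultimately show ?thesis
        using \<open>0 < \<gamma>\<close> by (simp only: pos_le_divide_eq) (simp add: pos_le_divide_eq algebra_simps)
    qed
    moreover have "summable q"
    proof (rule bounded_imp_summable[OF q_nonneg])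
      show "(\<Sum>i\<le>k. q i) \<le> K * V 0 / (2 * \<gamma>) / \<Lambda>" for k
        unfolding pos_le_divide_eq[OF \<open>0 < \<Lambda>\<close>]
        using sum_q[of k] by (simp add: atLeast0AtMost mult.commute)
    qed
    ultimately show ?thesis
      using Min_prefix_smallo[OF q_nonneg] by (simp add: \<Lambda>_def)
  qed

  \<comment> \<open>Ergodic rate with weights \<open>lam i\<close>\<close>
  have ergodic1: "1 / (\<Sum>i=0..k. lam i) * (\<Sum>i=0..k. lam i * q i)
      \<le> K * V 0 / (2 * \<gamma> * (\<Sum>i=0..k. lam i))" if lam: "\<forall>j. 0 < lam j \<and> lam j \<le> 1 / \<alpha>" for k
  proof -
    have "0 < (\<Sum>i=0..k. lam i)" using lam by (intro sum_pos) auto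
    then show ?thesis
      using sum_le[OF lam, of k] \<open>0 < \<gamma>\<close> by (simp add: field_simps)
  qed

  \<comment> \<open>Ergodic rate with linearly growing weights\<close>
  have ergodic2: "2 / ((real k + 1) * (real k + 2)) * (\<Sum>i=0..k. (real i + 1) * q i)
      \<le> K * V 0 / (\<gamma> * l * (real k + 1))"
    if l: "0 < l" "l \<le> 1 / \<alpha>" and lam: "\<forall>j. lam j = l" for k l
  proof -
    have step: "2 * \<gamma> * l * q i \<le> K * V i - K * V (Suc i)" for i
      using q_step[of i] lam l by (simp add: right_diff_distrib)
    have "0 \<le> 2 * \<gamma> * l * q i" for i
      using q_nonneg \<open>0 < \<gamma>\<close> l by simp
    then have "decseq (\<lambda>i. K * V i)"
      using step by (intro decseq_SucI) (smt (verit))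
    then have "(\<Sum>i=0..k. (real i + 1) * (2 * \<gamma> * l * q i)) \<le> (real k + 1) * (K * V 0)"
      using step V_nonneg \<open>0 \<le> K\<close>
      by (intro weighted_sum_le_telescope[where V = "\<lambda>i. K * V i"]) auto
    then have sum: "2 * \<gamma> * l * (\<Sum>i=0..k. (real i + 1) * q i) \<le> (real k + 1) * (K * V 0)"
      by (simp add: sum_distrib_left mult_ac)
    have "2 / ((real k + 1) * (real k + 2)) * (\<Sum>i=0..k. (real i + 1) * q i)
        = 2 * \<gamma> * l * (\<Sum>i=0..k. (real i + 1) * q i) / (\<gamma> * l * ((real k + 1) * (real k + 2)))"
      using \<open>0 < \<gamma>\<close> l by simp
    also have "\<dots> \<le> (real k + 1) * (K * V 0) / (\<gamma> * l * ((real k + 1) * (real k + 2)))"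
      using sum \<open>0 < \<gamma>\<close> l by (intro divide_right_mono) auto
    also have "\<dots> = K * V 0 / (\<gamma> * l * (real k + 2))"
    proof -
      have "real k + 1 \<noteq> 0" by linarith
      then show ?thesis by simp
    qed
    \<comment> \<open>Summation by parts gives the slightly sharper denominator with
      \<open>real k + 2\<close>, which is weakened here.\<close>
    also have "\<dots> \<le> K * V 0 / (\<gamma> * l * (real k + 1))"
      using \<open>0 < \<gamma>\<close> l \<open>0 \<le> K\<close> V_nonneg by (intro divide_left_mono mult_left_mono) auto
    finally show ?thesis .
  qed

  show ?thesis
    using nonergodic best ergodic1 ergodic2 unfolding K_def \<tau>_def V0 by blast
qed

end
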